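(* Let $p$ be an odd prime number and $n\geq1$. For any $n$ signed mass distributions $\mu_1,\ldots,\mu_n$ on $\mathbb{R}^{(p-1)n}$ there exists a single regular $p$-fan $F_p$ in $\mathbb{R}^{(p-1)n}$, with regular $p$-sectors $\mathcal{S}_0,\ldots,\mathcal{S}_{p-1}$, which equipartitions all of them: $$\mu_i(\mathcal{S}_0)=\mu_i(\mathcal{S}_1)=\cdots=\mu_i(\mathcal{S}_{p-1})=\frac1p\,\mu_i(\mathbb{R}^{(p-1)n})$$ for each $1\leq i\leq n$.
   Context: A signed mass distribution on $\mathbb{R}^N$ is a finite signed Borel measure $\mu$ on $\mathbb{R}^N$ (countably additive, with absolutely convergent sums, real-valued) such that $\mu(E)=0$ for every Borel set $E$ contained in an affine hyperplane, and $\mu(\mathbb{R}^N)\neq0$. A regular $m$-fan in $\mathbb{R}^N$ is the union of $m$ half-hyperplanes with common boundary a codimension-2 affine flat, with each angle between successive half-hyperplanes equal to $2\pi/m$. Its regular $m$-sectors $\mathcal{S}_0,\ldots,\mathcal{S}_{m-1}$ are the $m$ closed regions between successive half-hyperplanes, labelled in cyclic order around the flat. *)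

theory Defs
  imports "HOL-Analysis.Analysis" "HOL-Computational_Algebra.Primes"
begin

(* A finite signed Borel measure is represented by a real-valued set function;
   only its values on Borel sets are constrained. *)
definition finite_signed_borel_measure :: "('a::topological_space set \<Rightarrow> real) \<Rightarrow> bool" where
  "finite_signed_borel_measure \<mu> \<longleftrightarrow>
     \<mu> {} = 0 \<and>
     (\<forall>A :: nat \<Rightarrow> 'a set. range A \<subseteq> sets borel \<longrightarrow> disjoint_family A \<longrightarrow>
        summable (\<lambda>j. \<bar>\<mu> (A j)\<bar>) \<and> (\<lambda>j. \<mu> (A j)) sums \<mu> (\<Union>j. A j))"

definition signed_mass_distribution :: "('a::euclidean_space set \<Rightarrow> real) \<Rightarrow> bool" where
  "signed_mass_distribution \<mu> \<longleftrightarrow>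
     finite_signed_borel_measure \<mu> \<and>
     (\<forall>a b E. a \<noteq> 0 \<longrightarrow> E \<in> sets borel \<longrightarrow> E \<subseteq> {x. a \<bullet> x = b} \<longrightarrow> \<mu> E = 0) \<and>
     \<mu> UNIV \<noteq> 0"

definition codim2_flat :: "'a::euclidean_space set \<Rightarrow> bool" where
  "codim2_flat L \<longleftrightarrow> affine L \<and> aff_dim L = int DIM('a) - 2"

(* For a flat L of codimension 2, such u, v form an orthonormal basis of the plane
   orthogonal to the direction space of L. *)
definition orthonormal_frame_normal_to :: "'a::euclidean_space set \<Rightarrow> 'a \<Rightarrow> 'a \<Rightarrow> bool" where
  "orthonormal_frame_normal_to L u v \<longleftrightarrow>
     norm u = 1 \<and> norm v = 1 \<and> orthogonal u v \<and>
     (\<forall>x\<in>L. \<forall>y\<in>L. orthogonal (x - y) u \<and> orthogonal (x - y) v)"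

definition normal_direction :: "'a::euclidean_space \<Rightarrow> 'a \<Rightarrow> real \<Rightarrow> 'a" where
  "normal_direction u v \<theta> = cos \<theta> *\<^sub>R u + sin \<theta> *\<^sub>R v"

definition half_hyperplane :: "'a::euclidean_space set \<Rightarrow> 'a \<Rightarrow> 'a set" where
  "half_hyperplane L w = {x + r *\<^sub>R w | x r. x \<in> L \<and> 0 \<le> r}"

(* The closed region swept out by the half-hyperplanes with boundary L as the angle
   runs from \<alpha> to \<beta>. *)
definition closed_sector ::
    "'a::euclidean_space set \<Rightarrow> 'a \<Rightarrow> 'a \<Rightarrow> real \<Rightarrow> real \<Rightarrow> 'a set" where
  "closed_sector L u v \<alpha> \<beta> = (\<Union>\<theta>\<in>{\<alpha>..\<beta>}. half_hyperplane L (normal_direction u v \<theta>))"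

(* F is a regular m-fan and S 0, ..., S (m - 1) are its sectors in cyclic order. Measuring
   angles from the direction u loses no generality, since the frame (u, v) is arbitrary. *)
definition regular_fan_with_sectors ::
    "nat \<Rightarrow> 'a::euclidean_space set \<Rightarrow> (nat \<Rightarrow> 'a set) \<Rightarrow> bool" where
  "regular_fan_with_sectors m F S \<longleftrightarrow>
     (\<exists>L u v. codim2_flat L \<and> orthonormal_frame_normal_to L u v \<and>
        F = (\<Union>k<m. half_hyperplane L (normal_direction u v (2 * pi * real k / real m))) \<and>
        (\<forall>k<m. S k = closed_sector L u v (2 * pi * real k / real m)
                                         (2 * pi * real (k + 1) / real m)))"

end

(* Identify R^N, N = (p - 1) n even, with a Hermitian space. The complex-affine function with
   coefficients (a, b), a nonzero, pulls the standard regular p-fan of the plane back to a regular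
   p-fan of R^N, and multiplying (a, b) by exp(2 pi i / p) permutes the sectors cyclically. The
   numbers mu_i(S_j) - mu_i(R^N) / p define a map into n copies of the reduced regular
   representation of Z/p, which is equivariant, and it is continuous if b is restricted to the
   bisectors of the planar sectors. For a = 0 one sector is everything, so there the map does not
   vanish. That it vanishes somewhere is a Borsuk-Ulam theorem for Z/p.

   Borsuk-Ulam: in the parameter space there are chains c_0, ..., c_N with
   boundary c_(2k) = (1 + g + ... + g^(p-1)) c_(2k-1) and boundary c_(2k+1) = (g - 1) c_(2k), where
   c_0 is a point. If the map has no zero, label every parameter equivariantly by a pair (i, j) for
   which the value is maximal. On sufficiently fine subdivisions the labels of a simplex never
   contain a full orbit {i} x Z/p, so one gets an equivariant chain map into the flags of the join of n
   copies of the boundary of a (p-1)-simplex. That complex has dimension N - 1, so c_N maps to 0; it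
   is free since p is prime, and climbing down the chains by exactness of 1 + g + ... + g^(p-1) and
   g - 1 makes 1 divisible by p in degree -1. *)

theory Submission
  imports Defs "HOL-Library.Poly_Mapping" "HOL-Number_Theory.Cong"
begin

text \<open>The dimension count is tight. With \<open>a\<close> in R^N and \<open>b\<close> on one
  of p rays from 0, the unit parameters form p hemispheres of dimension N glued along the sphere
  S^(N-1) where b = 0. A map without zeros would lead from this complex to one of dimension N - 1.
  Admitting every \<open>b\<close> fails at a = 0: a sector there jumps between everything and
  nothing as \<open>b\<close> crosses a wall.

  The cycle on S^(N-1) is an iterated join of m = N / 2 polygons with p vertices, the orbits of an
  orthonormal complex basis; coning it to a point of one bisector gives c_N.

  Labels are maximal positions because the p values in a block sum to 0: if all p labels of a block
  occurred near one point, all p values there would be positive.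

  The descent needs the image of c_N to vanish, but ordered chains have degenerate simplices in
  every degree. Taking label sets, not labels, as vertices makes the image simplices weakly
  decreasing, so repeated entries are adjacent and can be discarded compatibly with the boundary and
  the action.\<close>

section \<open>Ordered chains\<close>

text \<open>The complex is augmented: a list of length \<open>k\<close> is an ordered simplex of dimension \<open>k - 1\<close>,
  and the empty list spans degree \<open>-1\<close>. Degenerate simplices are not divided out.\<close>

type_synonym 'a chain = "'a list \<Rightarrow>\<^sub>0 int"

definition cone_chain :: "'a \<Rightarrow> 'a chain \<Rightarrow> 'a chain" where
  "cone_chain x = frag_extend (\<lambda>l. frag_of (x # l))"

text \<open>Unfolds to the alternating sum over dropped entries. Written through the cone, its
  identities follow by induction on the list. The face of a single vertex is the empty list, which
  is the augmentation.\<close>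

primrec faces :: "'a list \<Rightarrow> 'a chain" where
  "faces [] = 0"
| "faces (x # l) = frag_of l - cone_chain x (faces l)"

definition boundary :: "'a chain \<Rightarrow> 'a chain" where
  "boundary = frag_extend faces"

definition push :: "('a \<Rightarrow> 'b) \<Rightarrow> 'a chain \<Rightarrow> 'b chain" where
  "push h = frag_extend (\<lambda>l. frag_of (map h l))"

lemma frag_extend_add_sum: "frag_extend f (\<Sum>i\<in>I. c i) = (\<Sum>i\<in>I. frag_extend f (c i))"
  by (induction I rule: infinite_finite_induct) (auto simp: frag_extend_add)

lemma cone_linear [simp]:
  "cone_chain x 0 = 0" "cone_chain x (a + b) = cone_chain x a + cone_chain x b" "cone_chain x (a - b) = cone_chain x a - cone_chain x b"
  "cone_chain x (frag_of l) = frag_of (x # l)"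
  by (simp_all add: cone_chain_def frag_extend_add frag_extend_diff)

lemma boundary_linear [simp]:
  "boundary 0 = 0" "boundary (a + b) = boundary a + boundary b"
  "boundary (a - b) = boundary a - boundary b"
  "boundary (\<Sum>i\<in>I. c i) = (\<Sum>i\<in>I. boundary (c i))"
  "boundary (frag_of l) = faces l"
  by (simp_all add: boundary_def frag_extend_add frag_extend_diff frag_extend_add_sum)

lemma push_linear [simp]:
  "push h 0 = 0" "push h (a + b) = push h a + push h b" "push h (a - b) = push h a - push h b"
  "push h (\<Sum>i\<in>I. c i) = (\<Sum>i\<in>I. push h (c i))" "push h (frag_of l) = frag_of (map h l)"
  by (simp_all add: push_def frag_extend_add frag_extend_diff frag_extend_add_sum)

lemma chain_induct [case_names zero one diff]:
  assumes "P 0" "\<And>l. P (frag_of l)" "\<And>a b. P a \<Longrightarrow> P b \<Longrightarrow> P (a - b)"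
  shows "P c"
  using frag_induction[of c UNIV P] assms by auto

text \<open>Thanks to the augmentation the cone formula has no exception in degree 0.\<close>

lemma boundary_cone [simp]: "boundary (cone_chain x c) = c - cone_chain x (boundary c)"
  by (induction c rule: chain_induct) auto

lemma boundary_faces [simp]: "boundary (faces l) = 0"
  by (induction l) auto

lemma boundary_boundary [simp]: "boundary (boundary c) = 0"
  by (induction c rule: chain_induct) auto

lemma push_cone [simp]: "push h (cone_chain x c) = cone_chain (h x) (push h c)"
  by (induction c rule: chain_induct) auto

lemma push_faces [simp]: "push h (faces l) = faces (map h l)"
  by (induction l) auto

lemma boundary_push [simp]: "boundary (push h c) = push h (boundary c)"
  by (induction c rule: chain_induct) auto

lemma push_push [simp]: "push h (push k c) = push (h \<circ> k) c"
  by (induction c rule: chain_induct) (auto simp: comp_def)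

lemma push_id [simp]: "push id c = c"
  by (induction c rule: chain_induct) auto

section \<open>Chains supported on a set of lists\<close>

definition chains_on :: "'a list set \<Rightarrow> 'a chain set" where
  "chains_on \<L> = {c. Poly_Mapping.keys c \<subseteq> \<L>}"

lemma chains_induct [consumes 1, case_names zero one diff]:
  assumes "c \<in> chains_on \<L>" "P 0" "\<And>l. l \<in> \<L> \<Longrightarrow> P (frag_of l)"
    "\<And>a b. P a \<Longrightarrow> P b \<Longrightarrow> P (a - b)"
  shows "P c"
  using assms unfolding chains_on_def by (auto intro: frag_induction[of c \<L> P])

lemma chains_0 [simp]: "0 \<in> chains_on \<L>"
  by (simp add: chains_on_def)

lemma chains_frag_of [simp]: "frag_of l \<in> chains_on \<L> \<longleftrightarrow> l \<in> \<L>"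
  by (simp add: chains_on_def)

lemma chains_diff: "a \<in> chains_on \<L> \<Longrightarrow> b \<in> chains_on \<L> \<Longrightarrow> a - b \<in> chains_on \<L>"
  using keys_diff[of a b] by (auto simp: chains_on_def)

lemma chains_mono: "c \<in> chains_on \<L> \<Longrightarrow> \<L> \<subseteq> \<M> \<Longrightarrow> c \<in> chains_on \<M>"
  by (auto simp: chains_on_def)

lemma chains_sum: "(\<And>i. i \<in> I \<Longrightarrow> c i \<in> chains_on \<L>) \<Longrightarrow> (\<Sum>i\<in>I. c i) \<in> chains_on \<L>"
  using keys_sum[of c I] by (fastforce simp: chains_on_def)

lemma chains_frag_extend:
  assumes "c \<in> chains_on \<L>" "\<And>l. l \<in> \<L> \<Longrightarrow> f l \<in> chains_on \<M>"
  shows "frag_extend f c \<in> chains_on \<M>"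
  using assms(1)
  by (induction rule: chains_induct) (auto simp: assms(2) frag_extend_diff chains_diff)

lemma chains_cone: "c \<in> chains_on \<L> \<Longrightarrow> (\<And>l. l \<in> \<L> \<Longrightarrow> x # l \<in> \<M>) \<Longrightarrow> cone_chain x c \<in> chains_on \<M>"
  unfolding cone_chain_def by (rule chains_frag_extend) auto

lemma chains_push: "c \<in> chains_on \<L> \<Longrightarrow> (\<And>l. l \<in> \<L> \<Longrightarrow> map h l \<in> \<M>) \<Longrightarrow> push h c \<in> chains_on \<M>"
  unfolding push_def by (rule chains_frag_extend) auto

lemma faces_sublists: "faces l \<in> chains_on {l'. set l' \<subseteq> set l \<and> Suc (length l') = length l}"
proof (induction l)
  case (Cons x l)
  have "cone_chain x (faces l) \<in> chains_on {l'. set l' \<subseteq> set (x # l) \<and> Suc (length l') = length (x # l)}"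
    by (rule chains_cone[OF Cons]) auto
  then show ?case by (auto intro!: chains_diff)
qed simp

lemma faces_sorted_wrt: "sorted_wrt R l \<Longrightarrow> faces l \<in> chains_on {l'. sorted_wrt R l'}"
proof (induction l)
  case (Cons x l)
  have "faces l \<in> chains_on {l'. set l' \<subseteq> set l \<and> sorted_wrt R l'}"
    using Cons faces_sublists[of l] by (auto simp: chains_on_def)
  then have "cone_chain x (faces l) \<in> chains_on {l'. sorted_wrt R l'}"
    by (rule chains_cone) (use Cons.prems in auto)
  with Cons.prems show ?case by (auto intro!: chains_diff)
qed simp

lemma boundary_chains:
  assumes "c \<in> chains_on {l. set l \<subseteq> V \<and> length l = Suc k}"
  shows "boundary c \<in> chains_on {l. set l \<subseteq> V \<and> length l = k}"
  unfolding boundary_def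
  using assms by (rule chains_frag_extend) (use faces_sublists in \<open>fastforce simp: chains_on_def\<close>)

text \<open>This is a chain map for every choice of apex \<open>\<beta>\<close>. It is used both for barycentric subdivision and,
  with \<open>\<beta>\<close> the set of labels of a simplex, for the map to flags.\<close>

primrec refine_list :: "('a list \<Rightarrow> 'b) \<Rightarrow> nat \<Rightarrow> 'a list \<Rightarrow> 'b chain" where
  "refine_list \<beta> 0 l = frag_of []"
| "refine_list \<beta> (Suc k) l = cone_chain (\<beta> l) (frag_extend (refine_list \<beta> k) (faces l))"

text \<open>The faces of a list are not structural subterms, so \<open>refine_list\<close> recurses
  on a dimension counter; here the counter is set to the length of each list.\<close>

definition refine :: "('a list \<Rightarrow> 'b) \<Rightarrow> 'a chain \<Rightarrow> 'b chain" where
  "refine \<beta> = frag_extend (\<lambda>l. refine_list \<beta> (length l) l)"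

lemma refine_linear [simp]:
  "refine \<beta> 0 = 0" "refine \<beta> (a + b) = refine \<beta> a + refine \<beta> b"
  "refine \<beta> (a - b) = refine \<beta> a - refine \<beta> b"
  "refine \<beta> (\<Sum>i\<in>I. c i) = (\<Sum>i\<in>I. refine \<beta> (c i))"
  "refine \<beta> (frag_of []) = frag_of []"
  by (simp_all add: refine_def frag_extend_add frag_extend_diff frag_extend_add_sum)

lemma refine_of:
  assumes "l \<noteq> []"
  shows "refine \<beta> (frag_of l) = cone_chain (\<beta> l) (refine \<beta> (faces l))"
proof -
  obtain k where k: "length l = Suc k" using assms by (cases l) auto
  have "frag_extend (refine_list \<beta> k) (faces l) = refine \<beta> (faces l)"
    unfolding refine_def
    by (rule frag_extend_eq) (use faces_sublists[of l] k in \<open>auto simp: chains_on_def\<close>)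
  then show ?thesis by (simp add: refine_def k)
qed

text \<open>The cone formula leaves \<open>refine \<beta> (faces l)\<close> minus a cone over its
  boundary; by induction that boundary is the refinement of
  \<open>boundary (faces l) = 0\<close>.\<close>

lemma boundary_refine [simp]: "boundary (refine \<beta> c) = refine \<beta> (boundary c)"
proof -
  have *: "boundary (refine \<beta> (frag_of l)) = refine \<beta> (faces l)" for l
  proof (induction "length l" arbitrary: l rule: less_induct)
    case less
    show ?case
    proof (cases "l = []")
      case False
      have "boundary (refine \<beta> c) = refine \<beta> (boundary c)"
        if "c \<in> chains_on {l'. length l' < length l}" for c
        using that by (induction rule: chains_induct) (auto simp: less)
      moreover have "faces l \<in> chains_on {l'. length l' < length l}"
        using faces_sublists[of l] by (rule chains_mono) auto
      ultimately show ?thesis by (simp add: refine_of False)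
    qed simp
  qed
  show ?thesis by (induction c rule: chain_induct) (auto simp: *)
qed

lemma refine_support:
  assumes ne: "\<And>l. l \<noteq> [] \<Longrightarrow> \<beta> l \<in> W (set l)"
    and mono: "\<And>A B. A \<subseteq> B \<Longrightarrow> W A \<subseteq> W B"
  shows "refine \<beta> (frag_of l) \<in> chains_on {l'. set l' \<subseteq> W (set l) \<and> length l' = length l}"
proof (induction "length l" arbitrary: l rule: less_induct)
  case less
  show ?case
  proof (cases "l = []")
    case False
    have "refine \<beta> (faces l) \<in> chains_on {l'. set l' \<subseteq> W (set l) \<and> Suc (length l') = length l}"
      unfolding refine_def
    proof (rule chains_frag_extend[OF faces_sublists])
      fix l' assume "l' \<in> {l'. set l' \<subseteq> set l \<and> Suc (length l') = length l}"
      then have "set l' \<subseteq> set l" and len: "Suc (length l') = length l" by auto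
      then show "refine_list \<beta> (length l') l' \<in>
          chains_on {l'. set l' \<subseteq> W (set l) \<and> Suc (length l') = length l}"
        using less[of l'] mono[of "set l'" "set l"] 
        by (auto simp: refine_def chains_on_def)
    qed
    then show ?thesis
      unfolding refine_of[OF False] by (rule chains_cone) (use ne False in auto)
  qed simp
qed

text \<open>Naturality in the apex. The restriction to lists over \<open>V\<close> matters because
  labels are equivariant only on the parameter space.\<close>

lemma push_refine:
  assumes "\<And>l. set l \<subseteq> V \<Longrightarrow> l \<noteq> [] \<Longrightarrow> \<beta>' (map h l) = h' (\<beta> l)"
    and "c \<in> chains_on {l. set l \<subseteq> V}"
  shows "refine \<beta>' (push h c) = push h' (refine \<beta> c)"
proof -
  have *: "set l \<subseteq> V \<Longrightarrow> refine \<beta>' (frag_of (map h l)) = push h' (refine \<beta> (frag_of l))" for l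
  proof (induction "length l" arbitrary: l rule: less_induct)
    case less
    show ?case
    proof (cases "l = []")
      case False
      have "refine \<beta>' (push h c) = push h' (refine \<beta> c)"
        if "c \<in> chains_on {l'. set l' \<subseteq> V \<and> length l' < length l}" for c
        using that by (induction rule: chains_induct) (auto simp: less)
      moreover have "faces l \<in> chains_on {l'. set l' \<subseteq> V \<and> length l' < length l}"
        using faces_sublists[of l] less.prems by (auto simp: chains_on_def)
      ultimately have "refine \<beta>' (push h (faces l)) = push h' (refine \<beta> (faces l))"
        by blast
      then show ?thesis using False less.prems by (simp add: refine_of assms)
    qed simp
  qed
  show ?thesis using assms(2) by (induction rule: chains_induct) (auto simp: *)
qed

text \<open>Normalization: on weakly decreasing lists, passing to the quotient by degenerate simplices.\<close>

definition strict_part :: "'a::order chain \<Rightarrow> 'a chain" where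
  "strict_part = frag_extend (\<lambda>l. if sorted_wrt (>) l then frag_of l else 0)"

lemma strict_part_linear [simp]:
  "strict_part 0 = 0" "strict_part (a + b) = strict_part a + strict_part b"
  "strict_part (a - b) = strict_part a - strict_part b"
  "strict_part (\<Sum>i\<in>I. c i) = (\<Sum>i\<in>I. strict_part (c i))"
  "strict_part (frag_of l) = (if sorted_wrt (>) l then frag_of l else 0)"
  by (simp_all add: strict_part_def frag_extend_add frag_extend_diff frag_extend_add_sum)

lemma strict_part_id: "c \<in> chains_on {l. sorted_wrt (>) l} \<Longrightarrow> strict_part c = c"
  by (induction rule: chains_induct) auto

lemma strict_part_cone:
  "c \<in> chains_on {l. \<forall>x\<in>set l. x < a} \<Longrightarrow> strict_part (cone_chain a c) = cone_chain a (strict_part c)"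
  by (induction rule: chains_induct) auto

lemma strict_part_cone_cone [simp]: "strict_part (cone_chain a (cone_chain a c)) = 0"
  by (induction c rule: chain_induct) auto

text \<open>Weak decrease puts equal entries next to each other. The two faces that drop one of two
  equal neighbours agree with opposite signs, and every other face still has a repetition.\<close>

lemma boundary_strict_part_of:
  "sorted_wrt (\<ge>) l \<Longrightarrow> boundary (strict_part (frag_of l)) = strict_part (faces l)"
proof (induction l)
  case (Cons a ys)
  show ?case
  proof (cases "sorted_wrt (>) (a # ys)")
    case True
    then have "strict_part (faces (a # ys)) = faces (a # ys)"
      using faces_sorted_wrt[of "(>)" "a # ys"] by (intro strict_part_id) auto
    with True show ?thesis by auto
  next
    case False
    then obtain b zs where ys: "ys = b # zs" by (cases ys) auto
    have ba: "b \<le> a" using Cons.prems ys by auto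
    show ?thesis
    proof (cases "a = b")
      case True
      with False ys show ?thesis by simp
    next
      case ab: False
      have lt: "\<forall>x\<in>set ys. x < a" using Cons.prems ba ab ys by fastforce
      then have nys: "\<not> sorted_wrt (>) ys" using False by auto
      have "faces ys \<in> chains_on {l. \<forall>x\<in>set l. x < a}"
        using faces_sublists[of ys] by (rule chains_mono) (use lt in auto)
      then have "strict_part (cone_chain a (faces ys)) = cone_chain a (strict_part (faces ys))"
        by (rule strict_part_cone)
      also have "strict_part (faces ys) = boundary (strict_part (frag_of ys))"
        using Cons by simp
      also have "\<dots> = 0" using nys by simp
      finally show ?thesis using nys False by simp
    qed
  qed
qed simp

lemma boundary_strict_part:
  "c \<in> chains_on {l. sorted_wrt (\<ge>) l} \<Longrightarrow> boundary (strict_part c) = strict_part (boundary c)"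
  by (induction rule: chains_induct) (auto simp del: strict_part_linear(5) simp: boundary_strict_part_of)

text \<open>Successive apexes belong to smaller and smaller faces, so a monotone
  \<open>\<beta>\<close> makes them decrease, though not strictly.\<close>

lemma refine_sorted:
  fixes \<beta> :: "'a list \<Rightarrow> 'b::order"
  assumes mono: "\<And>l l'. set l' \<subseteq> set l \<Longrightarrow> \<beta> l' \<le> \<beta> l"
  shows "refine \<beta> c \<in> chains_on {l. sorted_wrt (\<ge>) l}"
proof -
  have *: "refine \<beta> (frag_of l) \<in> chains_on {l'. (\<forall>x\<in>set l'. x \<le> \<beta> l) \<and> sorted_wrt (\<ge>) l'}" for l
  proof (induction "length l" arbitrary: l rule: less_induct)
    case less
    show ?case
    proof (cases "l = []")
      case False
      have "refine \<beta> (faces l) \<in> chains_on {l'. (\<forall>x\<in>set l'. x \<le> \<beta> l) \<and> sorted_wrt (\<ge>) l'}"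
        unfolding refine_def
      proof (rule chains_frag_extend[OF faces_sublists])
        fix l' assume "l' \<in> {l'. set l' \<subseteq> set l \<and> Suc (length l') = length l}"
        then have "\<beta> l' \<le> \<beta> l" "length l' < length l" using mono by auto
        then show "refine_list \<beta> (length l') l' \<in>
            chains_on {l'. (\<forall>x\<in>set l'. x \<le> \<beta> l) \<and> sorted_wrt (\<ge>) l'}"
          using less[of l'] by (auto simp: refine_def chains_on_def intro: order_trans)
      qed
      then show ?thesis
        unfolding refine_of[OF False] by (rule chains_cone) auto
    qed simp
  qed
  show ?thesis
    unfolding refine_def
    by (rule chains_frag_extend[of c UNIV]) (use * in \<open>auto simp: refine_def chains_on_def\<close>)
qed

lemma push_strict_part:
  assumes "\<And>x y. x \<in> V \<Longrightarrow> y \<in> V \<Longrightarrow> h x < h y \<longleftrightarrow> x < y"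
    and "c \<in> chains_on {l. set l \<subseteq> V}"
  shows "strict_part (push h c) = push h (strict_part c)"
proof -
  have *: "sorted_wrt (>) (map h l) \<longleftrightarrow> sorted_wrt (>) l" if "set l \<subseteq> V" for l
    using that by (induction l) (auto simp: assms(1) subset_iff)
  show ?thesis
    using assms(2) by (induction rule: chains_induct) (auto simp: *)
qed

section \<open>Free cyclic actions\<close>

definition norm_chain :: "nat \<Rightarrow> ('a \<Rightarrow> 'a) \<Rightarrow> 'a chain \<Rightarrow> 'a chain" where
  "norm_chain p h c = (\<Sum>j<p. push (h ^^ j) c)"

lemma boundary_norm_chain [simp]: "boundary (norm_chain p h c) = norm_chain p h (boundary c)"
  by (simp add: norm_chain_def)

lemma norm_chain_diff: "norm_chain p h (a - b) = norm_chain p h a - norm_chain p h b"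
  by (simp add: norm_chain_def sum_subtractf)

lemma push_norm_chain:
  assumes "push (h ^^ p) c = c"
  shows "push h (norm_chain p h c) = norm_chain p h c"
proof -
  have "push h (norm_chain p h c) = (\<Sum>j<p. push (h ^^ Suc j) c)"
    by (simp add: norm_chain_def)
  also have "\<dots> + push (h ^^ 0) c = (\<Sum>j<Suc p. push (h ^^ j) c)"
    by (subst sum.lessThan_Suc_shift) simp
  finally show ?thesis
    using assms by (simp add: norm_chain_def id_def[symmetric] del: push_push)
qed

lemma norm_chain_push_diff:
  assumes "push (h ^^ p) c = c"
  shows "norm_chain p h (push h c - c) = 0"
proof -
  have "norm_chain p h (push h c) = push h (norm_chain p h c)"
    by (simp add: norm_chain_def funpow_swap1 fun_eq_iff comp_def)
  then show ?thesis using push_norm_chain[OF assms] by (simp add: norm_chain_diff)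
qed

text \<open>Freeness is witnessed by \<open>t\<close>, an equivariant map to Z/p, which also
  supplies explicit orbit representatives.\<close>

locale free_cyclic_action =
  fixes p :: nat and h :: "'a \<Rightarrow> 'a" and V :: "'a set" and t :: "'a \<Rightarrow> nat"
  assumes p_pos: "0 < p"
    and h_closed: "x \<in> V \<Longrightarrow> h x \<in> V"
    and h_order: "x \<in> V \<Longrightarrow> (h ^^ p) x = x"
    and t_less: "x \<in> V \<Longrightarrow> t x < p"
    and t_shift: "x \<in> V \<Longrightarrow> t (h x) = Suc (t x) mod p"
begin

abbreviation simplices :: "nat \<Rightarrow> 'a list set" where
  "simplices k \<equiv> {l. set l \<subseteq> V \<and> length l = k}"

lemma funpow_closed: "x \<in> V \<Longrightarrow> (h ^^ j) x \<in> V"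
  by (induction j) (auto simp: h_closed)

lemma push_closed: "c \<in> chains_on (simplices k) \<Longrightarrow> push (h ^^ j) c \<in> chains_on (simplices k)"
  by (rule chains_push) (auto simp: funpow_closed subset_iff)

lemma t_funpow: "x \<in> V \<Longrightarrow> t ((h ^^ j) x) = (t x + j) mod p"
  by (induction j) (auto simp: t_less t_shift funpow_closed mod_Suc_eq)

text \<open>The position function \<open>t\<close> singles out one simplex in every orbit, namely the one whose head has
  position 0.\<close>

definition section_part :: "'a chain \<Rightarrow> 'a chain" where
  "section_part = frag_extend (\<lambda>l. if t (hd l) = 0 then frag_of l else 0)"

lemma section_part_linear [simp]:
  "section_part 0 = 0"
  "section_part (a - b) = section_part a - section_part b"
  "section_part (\<Sum>i\<in>I. c i) = (\<Sum>i\<in>I. section_part (c i))"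
  "section_part (frag_of l) = (if t (hd l) = 0 then frag_of l else 0)"
  by (simp_all add: section_part_def frag_extend_diff frag_extend_add_sum)

lemma section_part_closed: "c \<in> chains_on \<L> \<Longrightarrow> section_part c \<in> chains_on \<L>"
  unfolding section_part_def by (rule chains_frag_extend) auto

text \<open>In degrees from 0 on, the chains form a free module over the group ring with basis the
  lists whose head has position 0; the summand for \<open>j\<close> is the part of \<open>c\<close>
  in the j-th translate of that basis. The empty list is fixed by the action, hence
  \<open>Suc k\<close>.\<close>

lemma section_decomposition:
  assumes "c \<in> chains_on (simplices (Suc k))"
  shows "(\<Sum>j<p. push (h ^^ j) (section_part (push (h ^^ (p - j)) c))) = c"
  using assms
proof (induction rule: chains_induct)
  case (one l)
  then have hd: "hd l \<in> V" and l: "l \<noteq> []" by (cases l; auto)+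
  have "push (h ^^ j) (section_part (push (h ^^ (p - j)) (frag_of l))) =
      (if j = t (hd l) then frag_of l else 0)" if "j < p" for j
  proof -
    have "t (hd (map (h ^^ (p - j)) l)) = (t (hd l) + (p - j)) mod p"
      using hd l by (simp add: hd_map t_funpow)
    \<comment> \<open>Moving \<open>l\<close> back by \<open>j\<close> puts its head at position 0
      for exactly one \<open>j\<close>, so only one summand survives.\<close>
    moreover have "(t (hd l) + (p - j)) mod p = 0 \<longleftrightarrow> j = t (hd l)"
    proof (cases "j \<le> t (hd l)")
      case True
      then have "(t (hd l) + (p - j)) mod p = (t (hd l) - j + p) mod p" using that by simp
      also have "\<dots> = t (hd l) - j" using t_less[OF hd] by (simp add: less_imp_diff_less)
      finally show ?thesis using True by auto
    next
      case False
      then show ?thesis using that by auto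
    qed
    moreover have "map ((h ^^ j) \<circ> (h ^^ (p - j))) l = l"
    proof (rule map_idI)
      fix x assume "x \<in> set l"
      then have "(h ^^ (j + (p - j))) x = x" using that one by (auto simp: h_order)
      then show "((h ^^ j) \<circ> (h ^^ (p - j))) x = x" by (simp add: funpow_add)
    qed
    ultimately show ?thesis by auto
  qed
  then have "(\<Sum>j<p. push (h ^^ j) (section_part (push (h ^^ (p - j)) (frag_of l)))) =
     (\<Sum>j<p. if j = t (hd l) then frag_of l else 0)" by (intro sum.cong) auto
  then show ?case using t_less[OF hd] by simp
next
  case (diff a b)
  then show ?case by (simp add: sum_subtractf)
qed auto

text \<open>For invariant \<open>c\<close> all coefficients in the section decomposition equal
  \<open>section_part c\<close>.\<close>

lemma exact_norm:
  assumes c: "c \<in> chains_on (simplices (Suc k))" and inv: "push h c = c"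
  shows "norm_chain p h (section_part c) = c"
proof -
  have "push (h ^^ j) c = c" for j
  proof (induction j)
    case (Suc j)
    have "push (h ^^ Suc j) c = push h (push (h ^^ j) c)" by (simp add: comp_def)
    then show ?case using Suc inv by (simp only:)
  qed (simp flip: id_def)
  then show ?thesis using section_decomposition[OF c] by (simp add: norm_chain_def)
qed

text \<open>Write c as the sum of h^j e_j with e_j in the section. The e_j add up to the section
  part of the norm of c, hence to 0, so c is also the sum of (h^j - 1) e_j, and h^j - 1 = (h - 1)(1
  + ... + h^(j-1)).\<close>

lemma exact_shift:
  assumes c: "c \<in> chains_on (simplices (Suc k))" and z: "norm_chain p h c = 0"
  obtains y where "y \<in> chains_on (simplices (Suc k))" "push h y - y = c"
proof
  define e where "e j = section_part (push (h ^^ (p - j)) c)" for j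
  define y where "y = (\<Sum>j<p. \<Sum>i<j. push (h ^^ i) (e j))"
  have e: "e j \<in> chains_on (simplices (Suc k))" for j
    unfolding e_def by (intro section_part_closed push_closed c)
  show "y \<in> chains_on (simplices (Suc k))"
    unfolding y_def by (intro chains_sum push_closed e)
  have tele: "push h (\<Sum>i<j. push (h ^^ i) x) - (\<Sum>i<j. push (h ^^ i) x) = push (h ^^ j) x - x" for j x
  proof -
    have "push h (\<Sum>i<j. push (h ^^ i) x) = (\<Sum>i<j. push (h ^^ Suc i) x)" by simp
    then show ?thesis
      using sum_lessThan_telescope[of "\<lambda>i. push (h ^^ i) x" j] by (simp add: sum_subtractf)
  qed
  have "push h y - y = (\<Sum>j<p. push h (\<Sum>i<j. push (h ^^ i) (e j)) - (\<Sum>i<j. push (h ^^ i) (e j)))"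
    unfolding y_def push_linear(4)[of h "\<lambda>j. \<Sum>i<j. push (h ^^ i) (e j)"] by (simp add: sum_subtractf)
  also have "\<dots> = (\<Sum>j<p. push (h ^^ j) (e j)) - (\<Sum>j<p. e j)"
    unfolding tele by (simp add: sum_subtractf)
  also have "(\<Sum>j<p. push (h ^^ j) (e j)) = c"
    unfolding e_def by (rule section_decomposition[OF c])
  also have "(\<Sum>j<p. e j) = section_part (\<Sum>j<p. push (h ^^ (p - j)) c)"
    by (simp add: e_def)
  \<comment> \<open>The exponents run through 1, ..., p, which gives the norm shifted once.\<close>
  also have "(\<Sum>j<p. push (h ^^ (p - j)) c) = (\<Sum>j<p. push (h ^^ Suc j) c)"
    by (rule sum.reindex_bij_witness[of _ "\<lambda>j. p - Suc j" "\<lambda>j. p - Suc j"]) (auto simp: Suc_diff_Suc)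
  also have "\<dots> = push h (norm_chain p h c)" by (simp add: norm_chain_def)
  finally show "push h y - y = c" using z by simp
qed

text \<open>Descending from \<open>C m = 0\<close>, every \<open>Z k\<close> is the norm of a boundary. For \<open>k = 0\<close> this is impossible,
  since the action in degree \<open>-1\<close> is trivial and so norms are divisible by \<open>p\<close>.\<close>

lemma no_ladder:
  fixes Z C D :: "nat \<Rightarrow> 'a chain"
  assumes p: "1 < p"
    and Z0: "Z 0 = frag_of []"
    and bC: "\<And>k. k \<le> m \<Longrightarrow> boundary (C k) = Z k"
    and bD: "\<And>k. k < m \<Longrightarrow> boundary (D k) = push h (C k) - C k"
    and ZD: "\<And>k. k < m \<Longrightarrow> Z (Suc k) = norm_chain p h (D k)"
    and C: "\<And>k. k \<le> m \<Longrightarrow> C k \<in> chains_on (simplices (2 * k + 1))"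
    and D: "\<And>k. k < m \<Longrightarrow> D k \<in> chains_on (simplices (2 * k + 2))"
  shows "C m \<noteq> 0"
proof
  assume Cm: "C m = 0"
  have "\<exists>M \<in> chains_on (simplices (2 * (m - k) + 1)). Z (m - k) = norm_chain p h (boundary M)"
    if "k \<le> m" for k
    using that
  proof (induction k)
    case 0
    show ?case
      by (intro bexI[of _ 0]) (use bC[of m] Cm in \<open>auto simp: norm_chain_def\<close>)
  next
    case (Suc k)
    define q where "q = m - Suc k"
    have q: "q < m" "m - k = Suc q" "q \<le> m" using Suc.prems by (auto simp: q_def)
    obtain M where M: "M \<in> chains_on (simplices (2 * Suc q + 1))"
      and ZM: "Z (Suc q) = norm_chain p h (boundary M)"
      using Suc q by auto
    have bM: "boundary M \<in> chains_on (simplices (2 * q + 2))"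
      using boundary_chains[of M V "2 * q + 2"] M by simp
    \<comment> \<open>Both terms have norm \<open>Z (Suc q)\<close>, so their difference is
      \<open>push h y - y\<close> for some \<open>y\<close>.\<close>
    have "norm_chain p h (D q - boundary M) = 0"
      using ZM ZD[OF q(1)] by (simp add: norm_chain_diff)
    moreover have "D q - boundary M \<in> chains_on (simplices (Suc (2 * q + 1)))"
      using D[OF q(1)] bM by (auto intro: chains_diff)
    ultimately obtain y where y: "y \<in> chains_on (simplices (Suc (2 * q + 1)))"
      and yq: "push h y - y = D q - boundary M"
      using exact_shift by blast
    have "push h (boundary y) - boundary y = boundary (D q - boundary M)"
      by (simp flip: yq)
    \<comment> \<open>The boundaries of \<open>D q\<close> and of \<open>push h y - y\<close> agree,
      which makes \<open>C q - boundary y\<close> invariant, hence a norm of some \<open>x\<close>;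
      its boundary is still \<open>Z q\<close>.\<close>
    then have inv: "push h (C q - boundary y) = C q - boundary y"
      using bD[OF q(1)] by (simp add: algebra_simps)
    have bdy: "boundary y \<in> chains_on (simplices (Suc (2 * q)))"
      using boundary_chains[of y V "2 * q + 1"] y by simp
    have Cy: "C q - boundary y \<in> chains_on (simplices (Suc (2 * q)))"
      using C[OF q(3)] bdy by (auto intro: chains_diff)
    define x where "x = section_part (C q - boundary y)"
    have "norm_chain p h x = C q - boundary y"
      unfolding x_def by (rule exact_norm[OF Cy inv])
    then have "boundary (norm_chain p h x) = Z q"
      using bC[OF q(3)] by simp
    moreover have "x \<in> chains_on (simplices (2 * q + 1))"
      unfolding x_def using section_part_closed[OF Cy] by simp
    ultimately show ?case unfolding q_def[symmetric] by (metis boundary_norm_chain)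
  qed
  from this[of m] obtain M where "M \<in> chains_on (simplices 1)"
    and M: "frag_of [] = norm_chain p h (boundary M)"
    using Z0 by auto
  then have "boundary M \<in> chains_on {[]}"
    using boundary_chains[of M V 0] by (auto elim: chains_mono)
  then have "push (h ^^ j) (boundary M) = boundary M" for j
    by (induction rule: chains_induct) auto
  then have "frag_of [] = (\<Sum>j<p. boundary M)"
    using M by (simp add: norm_chain_def)
  also have "Poly_Mapping.lookup \<dots> [] = int p * Poly_Mapping.lookup (boundary M) []"
    by (simp add: lookup_sum)
  finally have "1 = int p * Poly_Mapping.lookup (boundary M) []" by simp
  then show False using p by (metis zmult_eq_1_iff of_nat_1_eq_iff less_not_refl zero_le_imp_eq_int not_less_iff_gr_or_eq of_nat_0_le_iff of_nat_less_iff int_one_le_iff_zero_less pos_zmult_eq_1_iff of_nat_0_less_iff p_pos)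
qed

end

section \<open>Barycentric subdivision\<close>

definition barycenter :: "'a::real_vector list \<Rightarrow> 'a" where
  "barycenter l = (1 / real (length l)) *\<^sub>R sum_list l"

lemma barycenter_map: "linear g \<Longrightarrow> barycenter (map g l) = g (barycenter l)"
proof -
  assume g: "linear g"
  have "sum_list (map g l) = g (sum_list l)"
    by (induction l) (auto simp: linear_0[OF g] linear_add[OF g])
  then show ?thesis by (simp add: barycenter_def linear_cmul[OF g])
qed

lemma barycenter_in_hull:
  assumes "l \<noteq> []"
  shows "barycenter l \<in> convex hull (set l)"
proof -
  have "(\<Sum>i<length l. (1 / real (length l)) *\<^sub>R l ! i) \<in> convex hull (set l)"
    by (rule convex_sum) (use assms in \<open>auto intro: hull_inc\<close>)
  then show ?thesis
    by (simp add: barycenter_def sum_list_sum_nth scaleR_sum_right atLeast0LessThan)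
qed

text \<open>The barycenter minus a vertex is an average of differences of vertices, one of which is
  0; this gives the factor (n - 1) / n. Balls are convex, so the bound extends from vertices to the
  hull.\<close>

lemma dist_barycenter_le:
  fixes l :: "'a::real_normed_vector list"
  assumes v: "v \<in> convex hull (set l)" and D: "\<And>x y. x \<in> set l \<Longrightarrow> y \<in> set l \<Longrightarrow> dist x y \<le> D"
  shows "dist (barycenter l) v \<le> (1 - 1 / real (length l)) * D"
proof -
  have *: "dist (barycenter l) v \<le> (1 - 1 / real (length l)) * D" if v: "v \<in> set l" for v
  proof -
    obtain i where i: "i < length l" "l ! i = v" using v by (auto simp: in_set_conv_nth)
    let ?n = "real (length l)"
    have n: "?n > 0" using i by (cases l) auto
    have "barycenter l - v = (1 / ?n) *\<^sub>R (\<Sum>k<length l. l ! k - v)"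
      using n by (simp add: barycenter_def sum_list_sum_nth sum_subtractf scaleR_diff_right
          atLeast0LessThan sum_constant_scaleR)
    also have "(\<Sum>k<length l. l ! k - v) = (\<Sum>k\<in>{..<length l} - {i}. l ! k - v)"
      using i by (subst sum.remove[of _ i]) auto
    finally have "dist (barycenter l) v = (1 / ?n) * norm (\<Sum>k\<in>{..<length l} - {i}. l ! k - v)"
      by (simp add: dist_norm)
    also have "norm (\<Sum>k\<in>{..<length l} - {i}. l ! k - v) \<le> (\<Sum>k\<in>{..<length l} - {i}. D)"
      by (rule sum_norm_le) (use D i v in \<open>auto simp: dist_norm\<close>)
    also have "\<dots> = (?n - 1) * D" using i by (simp add: of_nat_diff)
    finally show ?thesis using n by (simp add: field_simps)
  qed
  have "convex hull (set l) \<subseteq> cball (barycenter l) ((1 - 1 / real (length l)) * D)"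
    by (rule hull_minimal) (use * in auto)
  then show ?thesis using v by auto
qed

abbreviation subdivide :: "'a::real_vector chain \<Rightarrow> 'a chain" where
  "subdivide \<equiv> refine barycenter"

definition small_in_hull :: "real \<Rightarrow> 'a::real_normed_vector list \<Rightarrow> 'a list set" where
  "small_in_hull D l = {l'. set l' \<subseteq> convex hull (set l) \<and> length l' = length l \<and>
     (\<forall>x\<in>set l'. \<forall>y\<in>set l'. dist x y \<le> D)}"

text \<open>Distances to the apex are bounded by \<open>dist_barycenter_le\<close>, all others by
  induction on faces. The ratio uses a common length bound \<open>N\<close>, so that one factor
  serves all dimensions and can be iterated.\<close>

lemma subdivide_mesh:
  fixes l :: "'a::real_normed_vector list"
  assumes "length l \<le> N" "0 \<le> D" "\<And>x y. x \<in> set l \<Longrightarrow> y \<in> set l \<Longrightarrow> dist x y \<le> D"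
  shows "subdivide (frag_of l) \<in> chains_on (small_in_hull ((1 - 1 / real N) * D) l)"
  using assms(1,3)
proof (induction "length l" arbitrary: l rule: less_induct)
  case less
  let ?\<rho> = "1 - 1 / real N"
  show ?case
  proof (cases "l = []")
    case False
    let ?L = "{l'. set l' \<subseteq> convex hull (set l) \<and> Suc (length l') = length l \<and>
     (\<forall>x\<in>set l'. \<forall>y\<in>set l'. dist x y \<le> ?\<rho> * D)}"
    have "subdivide (faces l) \<in> chains_on ?L"
      unfolding refine_def
    proof (rule chains_frag_extend[OF faces_sublists])
      fix l' assume l': "l' \<in> {l'. set l' \<subseteq> set l \<and> Suc (length l') = length l}"
      then have "subdivide (frag_of l') \<in> chains_on (small_in_hull (?\<rho> * D) l')"
        using less.prems by (intro less.hyps) auto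
      moreover have "convex hull (set l') \<subseteq> convex hull (set l)"
        using l' by (intro hull_mono) auto
      ultimately show "refine_list barycenter (length l') l' \<in> chains_on ?L"
        using l' by (fastforce simp: refine_def chains_on_def small_in_hull_def)
    qed
    moreover have "barycenter l \<in> convex hull (set l)"
      using False by (rule barycenter_in_hull)
    moreover have "dist (barycenter l) x \<le> ?\<rho> * D" if "x \<in> convex hull (set l)" for x
    proof -
      have "dist (barycenter l) x \<le> (1 - 1 / real (length l)) * D"
        by (rule dist_barycenter_le[OF that less.prems(2)])
      also have "\<dots> \<le> ?\<rho> * D"
        using False less.prems(1) assms(2)
        by (cases l) (auto intro!: mult_right_mono diff_left_mono divide_left_mono)
      finally show ?thesis .
    qed
    moreover have "0 \<le> ?\<rho> * D"
      using False less.prems(1) assms(2) by (cases l) (auto intro!: mult_nonneg_nonneg)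
    ultimately show ?thesis
      unfolding refine_of[OF False] small_in_hull_def
      by (intro chains_cone) (auto simp: dist_commute subset_iff)
  qed (simp add: small_in_hull_def)
qed

lemma subdivide_iterated_mesh:
  fixes c :: "'a::real_normed_vector chain"
  assumes c: "c \<in> chains_on \<L>" and "0 \<le> D" "0 < N"
    and \<L>: "\<And>l. l \<in> \<L> \<Longrightarrow> length l \<le> N \<and> (\<forall>x\<in>set l. \<forall>y\<in>set l. dist x y \<le> D)"
  shows "(subdivide ^^ r) c \<in> chains_on (\<Union>l\<in>\<L>. small_in_hull ((1 - 1 / real N) ^ r * D) l)"
proof (induction r)
  case 0
  show ?case
    using c \<L> by (auto elim!: chains_mono simp: small_in_hull_def hull_inc)
next
  case (Suc r)
  let ?\<rho> = "1 - 1 / real N"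
  have "subdivide ((subdivide ^^ r) c) \<in> chains_on (\<Union>l\<in>\<L>. small_in_hull (?\<rho> ^ Suc r * D) l)"
    unfolding refine_def[of barycenter]
  proof (rule chains_frag_extend[OF Suc, unfolded refine_def])
    fix l' assume "l' \<in> (\<Union>l\<in>\<L>. small_in_hull (?\<rho> ^ r * D) l)"
    then obtain l where l: "l \<in> \<L>" "l' \<in> small_in_hull (?\<rho> ^ r * D) l" by auto
    have "subdivide (frag_of l') \<in> chains_on (small_in_hull (?\<rho> * (?\<rho> ^ r * D)) l')"
      using l \<L>[OF l(1)] assms(2,3)
      by (intro subdivide_mesh) (auto simp: small_in_hull_def)
    moreover have "convex hull (set l') \<subseteq> convex hull (set l)"
      using l by (intro hull_minimal) (auto simp: small_in_hull_def)
    then have "small_in_hull (?\<rho> * (?\<rho> ^ r * D)) l' \<subseteq> small_in_hull (?\<rho> ^ Suc r * D) l"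
      using l by (auto simp: small_in_hull_def mult.assoc)
    ultimately show "refine_list barycenter (length l') l' \<in>
        chains_on (\<Union>l\<in>\<L>. small_in_hull (?\<rho> ^ Suc r * D) l)"
      using l(1) by (auto simp: refine_def chains_on_def)
  qed
  then show ?case by simp
qed

section \<open>Equivariant labels\<close>

definition cyc :: "nat \<Rightarrow> nat \<Rightarrow> nat" where
  "cyc p j = Suc j mod p"

lemma cyc_less: "0 < p \<Longrightarrow> cyc p j < p"
  by (simp add: cyc_def)

lemma inj_on_cyc: "inj_on (cyc p) {..<p}"
  by (auto simp: inj_on_def cyc_def mod_Suc split: if_splits)

text \<open>The mean of \<open>A\<close> modulo \<open>p\<close>. For a proper nonempty \<open>A\<close> it exists because \<open>p\<close> is prime, and it
  moves along with \<open>A\<close> under cyclic shifts; this makes the action on proper subsets free.\<close>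

definition residue_index :: "nat \<Rightarrow> nat set \<Rightarrow> nat" where
  "residue_index p A = ((SOME u. [card A * u = 1] (mod p)) * \<Sum>A) mod p"

text \<open>A cyclic shift adds \<open>card A\<close> to the sum modulo \<open>p\<close>; multiplied
  by the inverse of \<open>card A\<close> this is 1.\<close>

lemma residue_index_cyc:
  assumes p: "prime p" and A: "A \<subset> {..<p}" "A \<noteq> {}"
  shows "residue_index p (cyc p ` A) = cyc p (residue_index p A)"
proof -
  have inj: "inj_on (cyc p) A" using inj_on_cyc A by (auto intro: inj_on_subset)
  have fin: "finite A" using A finite_subset[of A "{..<p}"] by auto
  have "card A < p" using psubset_card_mono[OF _ A(1)] by simp
  moreover have "0 < card A" using A fin by (simp add: card_gt_0_iff)
  ultimately have "coprime (card A) p"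
    using p by (metis coprime_commute nat_dvd_not_less prime_imp_coprime)
  then have "\<exists>u. [card A * u = 1] (mod p)" using cong_solve_coprime_nat by simp
  define u where "u = (SOME u. [card A * u = 1] (mod p))"
  have u: "[card A * u = 1] (mod p)"
    unfolding u_def by (rule someI_ex) fact
  have "\<Sum>(cyc p ` A) = (\<Sum>j\<in>A. Suc j mod p)"
    by (subst sum.reindex[OF inj]) (simp add: cyc_def)
  also have "[(\<Sum>j\<in>A. Suc j mod p) = (\<Sum>j\<in>A. Suc j)] (mod p)"
    by (intro cong_sum) simp
  also have "(\<Sum>j\<in>A. Suc j) = \<Sum>A + card A"
    by (simp add: Suc_eq_plus1 sum.distrib del: One_nat_def)
  finally have "[u * \<Sum>(cyc p ` A) = u * (\<Sum>A + card A)] (mod p)"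
    by (rule cong_mult[OF cong_refl])
  also have "u * (\<Sum>A + card A) = u * \<Sum>A + card A * u" by (simp add: algebra_simps)
  also have "[\<dots> = u * \<Sum>A + 1] (mod p)" using u by (intro cong_add) auto
  finally show ?thesis
    unfolding residue_index_def card_image[OF inj] u_def[symmetric]
    by (simp add: cyc_def cong_def mod_Suc_eq)
qed

definition shift_label :: "nat \<Rightarrow> nat \<times> nat \<Rightarrow> nat \<times> nat" where
  "shift_label p = (\<lambda>(i, j). (i, cyc p j))"

text \<open>The nonempty simplices of the join of n copies of the boundary of a (p-1)-simplex; flags
  of such sets are the simplices of its barycentric subdivision.\<close>

definition proper_label_sets :: "nat \<Rightarrow> nat \<Rightarrow> (nat \<times> nat) set set" where
  "proper_label_sets p n =
     {A. A \<subseteq> {..<n} \<times> {..<p} \<and> A \<noteq> {} \<and> (\<forall>i. A `` {i} \<noteq> {..<p})}"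

definition first_index :: "(nat \<times> nat) set \<Rightarrow> nat" where
  "first_index A = (LEAST i. A `` {i} \<noteq> {})"

text \<open>The position function of the free action on label sets: shifting preserves each block,
  hence also which block is the first nonempty one.\<close>

definition label_index :: "nat \<Rightarrow> (nat \<times> nat) set \<Rightarrow> nat" where
  "label_index p A = residue_index p (A `` {first_index A})"

text \<open>The block is searched cyclically starting at its mean. Starting at a fixed residue would
  not commute with the shift.\<close>

definition choose_label :: "nat \<Rightarrow> (nat \<times> nat) set \<Rightarrow> nat \<times> nat" where
  "choose_label p A = (first_index A,
     (label_index p A + (LEAST d. (label_index p A + d) mod p \<in> A `` {first_index A})) mod p)"

lemma shift_label_slice: "(shift_label p ` A) `` {i} = cyc p ` (A `` {i})"
  by (force simp: shift_label_def image_iff)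

lemma first_index_shift: "first_index (shift_label p ` A) = first_index A"
  by (simp add: first_index_def shift_label_slice)

lemma first_slice:
  assumes "A \<in> proper_label_sets p n"
  shows "A `` {first_index A} \<subset> {..<p}" "A `` {first_index A} \<noteq> {}"
proof -
  have "\<exists>i. A `` {i} \<noteq> {}" using assms by (auto simp: proper_label_sets_def)
  then show "A `` {first_index A} \<noteq> {}"
    unfolding first_index_def by (rule LeastI_ex)
  show "A `` {first_index A} \<subset> {..<p}"
    using assms by (auto simp: proper_label_sets_def)
qed

lemma label_index_less: "0 < p \<Longrightarrow> label_index p A < p"
  by (simp add: label_index_def residue_index_def)

lemma label_index_shift:
  assumes "prime p" "A \<in> proper_label_sets p n"
  shows "label_index p (shift_label p ` A) = Suc (label_index p A) mod p"
  using residue_index_cyc[OF assms(1) first_slice[OF assms(2)]]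
  by (simp add: label_index_def first_index_shift shift_label_slice cyc_def)

lemma shift_label_less: "0 < p \<Longrightarrow> x \<in> {..<n} \<times> {..<p} \<Longrightarrow> shift_label p x \<in> {..<n} \<times> {..<p}"
  by (auto simp: shift_label_def cyc_less)

lemma inj_on_shift_label: "inj_on (shift_label p) ({..<n} \<times> {..<p})"
  using inj_on_cyc[of p] by (auto simp: inj_on_def shift_label_def)

lemma shift_label_closed:
  assumes p: "0 < p" and A: "A \<in> proper_label_sets p n"
  shows "shift_label p ` A \<in> proper_label_sets p n"
proof -
  have "cyc p ` (A `` {i}) \<noteq> {..<p}" for i
  proof
    assume *: "cyc p ` (A `` {i}) = {..<p}"
    have "A `` {i} \<subset> {..<p}" using A by (auto simp: proper_label_sets_def)
    then have "card (A `` {i}) < p" and "finite (A `` {i})"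
      using psubset_card_mono[of "{..<p}" "A `` {i}"] finite_subset[of "A `` {i}" "{..<p}"] by auto
    then show False using card_image_le[of "A `` {i}" "cyc p"] * by simp
  qed
  moreover have "shift_label p ` A \<subseteq> {..<n} \<times> {..<p}"
    using A shift_label_less[OF p] unfolding proper_label_sets_def by blast
  ultimately show ?thesis
    using A by (simp add: proper_label_sets_def shift_label_slice)
qed

lemma shift_label_funpow: "x \<in> {..<n} \<times> {..<p} \<Longrightarrow> (shift_label p ^^ k) x = (fst x, (snd x + k) mod p)"
proof (induction k)
  case (Suc k)
  then show ?case by (auto simp: shift_label_def cyc_def mod_Suc_eq)
qed auto

lemma image_funpow: "((`) (h :: 'a \<Rightarrow> 'a) ^^ k) A = (h ^^ k) ` A"
  by (induction k) (auto simp: image_image)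

lemma shift_label_order:
  assumes "A \<in> proper_label_sets p n"
  shows "((`) (shift_label p) ^^ p) A = A"
proof -
  have "(shift_label p ^^ p) x = x" if "x \<in> A" for x
    using assms that shift_label_funpow[of x n p p] by (auto simp: proper_label_sets_def)
  then show ?thesis by (simp add: image_funpow)
qed

lemma choose_label_in:
  assumes p: "0 < p" and A: "A \<in> proper_label_sets p n"
  shows "choose_label p A \<in> A"
proof -
  obtain j where j: "j \<in> A `` {first_index A}" "j < p"
    using first_slice[OF A] by auto
  let ?t = "label_index p A"
  have "(?t + (p - ?t + j)) mod p = j"
    using label_index_less[OF p, of A] j by (simp add: add.assoc[symmetric])
  then have "\<exists>d. (?t + d) mod p \<in> A `` {first_index A}" using j by metis
  then have "(?t + (LEAST d. (?t + d) mod p \<in> A `` {first_index A})) mod p \<in> A `` {first_index A}"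
    by (rule LeastI_ex)
  then show ?thesis by (simp add: choose_label_def)
qed

lemma choose_label_shift:
  assumes p: "prime p" and A: "A \<in> proper_label_sets p n"
  shows "choose_label p (shift_label p ` A) = shift_label p (choose_label p A)"
proof -
  let ?t = "label_index p A" and ?S = "A `` {first_index A}"
  have p0: "0 < p" using p prime_gt_0_nat by blast
  have shift: "(Suc ?t mod p + d) mod p = cyc p ((?t + d) mod p)" for d
    unfolding cyc_def by (metis add_Suc mod_Suc_eq mod_add_left_eq)
  have "cyc p ((?t + d) mod p) \<in> cyc p ` ?S \<longleftrightarrow> (?t + d) mod p \<in> ?S" for d
    using inj_on_image_mem_iff[OF inj_on_cyc, of "(?t + d) mod p" p ?S] first_slice[OF A] p0 by auto
  then show ?thesis
    unfolding choose_label_def first_index_shift label_index_shift[OF p A] shift_label_slice shift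
    by (simp add: shift_label_def)
qed

text \<open>Each of the n blocks misses a residue. This is the bound N on the number of vertices, so
  the target complex has dimension at most N - 1.\<close>

lemma card_proper_label_set:
  assumes "A \<in> proper_label_sets p n"
  shows "card A \<le> (p - 1) * n"
proof -
  have "A = (SIGMA i:{..<n}. A `` {i})"
    using assms by (auto simp: proper_label_sets_def)
  moreover have "card (SIGMA i:{..<n}. A `` {i}) = (\<Sum>i<n. card (A `` {i}))"
    using assms by (intro card_SigmaI) (auto simp: proper_label_sets_def intro: finite_subset[of _ "{..<p}"])
  moreover have "card (A `` {i}) \<le> p - 1" for i
  proof -
    have "A `` {i} \<subset> {..<p}" using assms by (auto simp: proper_label_sets_def)
    then have "card (A `` {i}) < p" using psubset_card_mono[of "{..<p}" "A `` {i}"] by auto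
    then show ?thesis by simp
  qed
  ultimately show ?thesis
    using sum_bounded_above[of "{..<n}" "\<lambda>i. card (A `` {i})" "p - 1"] by (simp add: mult.commute)
qed

lemma strictly_decreasing_sets_length:
  fixes l :: "'a set list"
  assumes "sorted_wrt (>) l" "l \<noteq> []" "\<And>A. A \<in> set l \<Longrightarrow> finite A \<and> A \<noteq> {}"
  shows "length l \<le> card (hd l)"
  using assms
proof (induction l)
  case (Cons A l)
  show ?case
  proof (cases "l = []")
    case True
    with Cons.prems show ?thesis by (simp add: Suc_le_eq card_gt_0_iff)
  next
    case False
    then have "length l \<le> card (hd l)" using Cons by auto
    also have "hd l \<subset> A" using Cons.prems False by auto
    then have "card (hd l) < card A" using Cons.prems by (intro psubset_card_mono) auto
    finally show ?thesis by simp
  qed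
qed simp

section \<open>A Borsuk--Ulam theorem for cyclic groups of prime order\<close>

text \<open>The norm of the edge from \<open>v k\<close> to \<open>g (v k)\<close> is a closed
  polygon, so step \<open>k\<close> joins the previous, invariant cycle with the polygon on the
  orbit of \<open>v k\<close>. The result is a cycle of dimension 2k - 1.\<close>

primrec ladder_cycle :: "nat \<Rightarrow> ('a \<Rightarrow> 'a) \<Rightarrow> (nat \<Rightarrow> 'a) \<Rightarrow> nat \<Rightarrow> 'a chain" where
  "ladder_cycle p g v 0 = frag_of []"
| "ladder_cycle p g v (Suc k) =
     norm_chain p g (cone_chain (v k) (cone_chain (g (v k)) (ladder_cycle p g v k)))"

lemma ladder_cycle_properties:
  assumes "(g ^^ p) = id"
  shows "boundary (ladder_cycle p g v k) = 0 \<and> push g (ladder_cycle p g v k) = ladder_cycle p g v k"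
proof (induction k)
  case (Suc k)
  let ?z = "ladder_cycle p g v k"
  have o: "push (g ^^ p) c = c" for c :: "'a chain" by (simp add: assms)
  have "boundary (ladder_cycle p g v (Suc k)) = norm_chain p g (cone_chain (g (v k)) ?z - cone_chain (v k) ?z)"
    using Suc by simp
  also have "cone_chain (g (v k)) ?z - cone_chain (v k) ?z = push g (cone_chain (v k) ?z) - cone_chain (v k) ?z"
    using Suc by simp
  also have "norm_chain p g \<dots> = 0" by (rule norm_chain_push_diff[OF o])
  finally show ?case using push_norm_chain[OF o] by simp
qed simp

text \<open>The vertices of one simplex of the join: from polygon \<open>i\<close> the two ends of
  edge number \<open>J i\<close>.\<close>

definition ladder_vertices :: "('a \<Rightarrow> 'a) \<Rightarrow> (nat \<Rightarrow> 'a) \<Rightarrow> (nat \<Rightarrow> nat) \<Rightarrow> nat \<Rightarrow> 'a set" where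
  "ladder_vertices g v J k = (\<Union>i<k. {(g ^^ J i) (v i), (g ^^ Suc (J i)) (v i)})"

lemma ladder_cycle_support:
  "ladder_cycle p g v k \<in> chains_on {l. length l = 2 * k \<and> (\<exists>J. set l \<subseteq> ladder_vertices g v J k)}"
proof (induction k)
  case (Suc k)
  let ?L = "\<lambda>k. {l. length l = 2 * k \<and> (\<exists>J. set l \<subseteq> ladder_vertices g v J k)}"
  have "cone_chain (v k) (cone_chain (g (v k)) (ladder_cycle p g v k)) \<in> chains_on (?L (Suc k))"
    unfolding cone_chain_def
  proof (intro chains_frag_extend[OF chains_frag_extend[OF Suc]])
    show "frag_of (g (v k) # l) \<in> chains_on {g (v k) # l | l. l \<in> ?L k}" if "l \<in> ?L k" for l
      using that by auto
    fix l assume "l \<in> {g (v k) # l | l. l \<in> ?L k}"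
    then obtain l' J where l: "l = g (v k) # l'" "length l' = 2 * k" "set l' \<subseteq> ladder_vertices g v J k"
      by auto
    \<comment> \<open>The new edge starts at \<open>v k\<close> itself, so its number is 0.\<close>
    have "set (v k # l) \<subseteq> ladder_vertices g v (J(k := 0)) (Suc k)"
      using l by (fastforce simp: ladder_vertices_def lessThan_Suc)
    then show "frag_of (v k # l) \<in> chains_on (?L (Suc k))" using l by auto
  qed
  then have "push (g ^^ j) (cone_chain (v k) (cone_chain (g (v k)) (ladder_cycle p g v k))) \<in> chains_on (?L (Suc k))" for j
  proof (rule chains_push)
    fix l assume "l \<in> ?L (Suc k)"
    then obtain J where J: "length l = 2 * Suc k" "set l \<subseteq> ladder_vertices g v J (Suc k)" by auto
    have "set (map (g ^^ j) l) \<subseteq> (g ^^ j) ` ladder_vertices g v J (Suc k)" using J by auto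
    \<comment> \<open>Translation by g^j advances every edge number by \<open>j\<close>.\<close>
    also have "\<dots> = ladder_vertices g v (\<lambda>i. j + J i) (Suc k)"
      unfolding ladder_vertices_def image_UN by (simp add: funpow_add funpow_swap1)
    finally show "map (g ^^ j) l \<in> ?L (Suc k)" using J by auto
  qed
  then show ?case unfolding ladder_cycle.simps norm_chain_def by (intro chains_sum)
qed simp

text \<open>A hypothetical equivariant map without zeros into n copies of the reduced regular
  representation; with continuity and the ladder inside \<open>X\<close> it is
  contradictory.\<close>

locale equivariant_family =
  fixes p n :: nat and g :: "'e::real_normed_vector \<Rightarrow> 'e" and X :: "'e set"
    and f :: "nat \<Rightarrow> nat \<Rightarrow> 'e \<Rightarrow> real"
  assumes prime_p: "prime p"
    and g_X: "x \<in> X \<Longrightarrow> g x \<in> X"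
    and f_sum: "x \<in> X \<Longrightarrow> i < n \<Longrightarrow> (\<Sum>j<p. f i j x) = 0"
    and f_g: "x \<in> X \<Longrightarrow> i < n \<Longrightarrow> j < p \<Longrightarrow> f i (cyc p j) (g x) = f i j x"
    and f_nonzero: "x \<in> X \<Longrightarrow> \<exists>i<n. \<exists>j<p. f i j x \<noteq> 0"
begin

lemma p_gt_0: "0 < p"
  using prime_p prime_gt_0_nat by blast

definition top_value :: "'e \<Rightarrow> real" where
  "top_value x = Max ((\<lambda>(i, j). f i j x) ` ({..<n} \<times> {..<p}))"

definition top_set :: "'e \<Rightarrow> (nat \<times> nat) set" where
  "top_set x = {(i, j) \<in> {..<n} \<times> {..<p}. f i j x = top_value x}"

definition label :: "'e \<Rightarrow> nat \<times> nat" where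
  "label x = choose_label p (top_set x)"

lemma n_pos: "x \<in> X \<Longrightarrow> 0 < n"
  using f_nonzero[of x] by auto

lemma exists_pos: assumes x: "x \<in> X" shows "\<exists>i<n. \<exists>j<p. f i j x > 0"
proof (rule ccontr)
  assume neg: "\<not> ?thesis"
  obtain i j where ij: "i < n" "j < p" "f i j x \<noteq> 0" using f_nonzero[OF x] by auto
  have "\<And>j. j < p \<Longrightarrow> f i j x \<le> 0" using neg ij(1) by (meson linorder_not_le)
  moreover have "(\<Sum>j<p. - f i j x) = 0"
    using f_sum[OF x ij(1)] by (simp add: sum_negf)
  ultimately have "\<forall>j\<in>{..<p}. - f i j x = 0"
    using sum_nonneg_eq_0_iff[of "{..<p}" "\<lambda>j. - f i j x"] by simp
  then show False using ij by simp
qed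

lemma top_value_ge: "i < n \<Longrightarrow> j < p \<Longrightarrow> f i j x \<le> top_value x"
  unfolding top_value_def by (rule Max_ge) auto

lemma top_value_pos: "x \<in> X \<Longrightarrow> top_value x > 0"
  using exists_pos top_value_ge by (meson less_le_trans)

lemma top_value_attained: assumes "x \<in> X" shows "\<exists>i<n. \<exists>j<p. f i j x = top_value x"
proof -
  have "top_value x \<in> (\<lambda>(i, j). f i j x) ` ({..<n} \<times> {..<p})"
    unfolding top_value_def using n_pos[OF assms] p_gt_0 by (intro Max_in) auto
  then obtain i j where "i < n" "j < p" "top_value x = f i j x" by auto
  then show ?thesis by metis
qed

text \<open>If a whole block attained the maximum, its values would be equal and positive, yet sum
  to 0.\<close>

lemma top_set_proper: assumes x: "x \<in> X" shows "top_set x \<in> proper_label_sets p n"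
proof -
  have "top_set x `` {i} \<noteq> {..<p}" for i
  proof
    assume eq: "top_set x `` {i} = {..<p}"
    then have "(i, 0) \<in> top_set x" using p_gt_0 by auto
    then have "i < n" by (auto simp: top_set_def)
    moreover have "f i j x = top_value x" if "j < p" for j
      using that eq by (auto simp: top_set_def)
    ultimately have "(\<Sum>j<p. top_value x) = 0" using f_sum[OF x, of i] by simp
    then show False using p_gt_0 top_value_pos[OF x] by simp
  qed
  moreover have "top_set x \<noteq> {}" using top_value_attained[OF x] by (auto simp: top_set_def)
  ultimately show ?thesis by (auto simp: proper_label_sets_def top_set_def)
qed

lemma shift_label_image_eq: "shift_label p ` ({..<n} \<times> {..<p}) = {..<n} \<times> {..<p}"
  by (rule endo_inj_surj) (use shift_label_less[OF p_gt_0] inj_on_shift_label in blast)+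

lemma top_value_g: assumes x: "x \<in> X" shows "top_value (g x) = top_value x"
proof -
  have "top_value (g x) = Max ((\<lambda>(i, j). f i j (g x)) ` shift_label p ` ({..<n} \<times> {..<p}))"
    unfolding top_value_def shift_label_image_eq ..
  also have "(\<lambda>(i, j). f i j (g x)) ` shift_label p ` ({..<n} \<times> {..<p}) =
      (\<lambda>(i, j). f i j x) ` ({..<n} \<times> {..<p})"
    unfolding image_image by (intro image_cong) (auto simp: shift_label_def f_g[OF x])
  finally show ?thesis by (simp add: top_value_def)
qed

lemma top_set_g: assumes x: "x \<in> X" shows "top_set (g x) = shift_label p ` top_set x"
proof -
  have *: "shift_label p a \<in> top_set (g x) \<longleftrightarrow> a \<in> top_set x" if "a \<in> {..<n} \<times> {..<p}" for a
    using that f_g[OF x] top_value_g[OF x] p_gt_0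
    by (auto simp: top_set_def shift_label_def cyc_less)
  have sub: "top_set y \<subseteq> {..<n} \<times> {..<p}" for y by (auto simp: top_set_def)
  show ?thesis
  proof (intro equalityI subsetI)
    fix b assume b: "b \<in> top_set (g x)"
    then obtain a where "a \<in> {..<n} \<times> {..<p}" "b = shift_label p a"
      using shift_label_image_eq sub by blast
    then show "b \<in> shift_label p ` top_set x" using * b by auto
  qed (use * sub in blast)
qed

lemma label_g: "x \<in> X \<Longrightarrow> label (g x) = shift_label p (label x)"
  unfolding label_def by (simp add: top_set_g choose_label_shift[OF prime_p top_set_proper])

lemma label_top: "x \<in> X \<Longrightarrow> label x \<in> top_set x"
  unfolding label_def by (rule choose_label_in[OF p_gt_0 top_set_proper])

lemma top_set_range: "top_set x \<subseteq> {..<n} \<times> {..<p}"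
  by (auto simp: top_set_def)

lemma label_range: "x \<in> X \<Longrightarrow> label x \<in> {..<n} \<times> {..<p}"
  using subsetD[OF top_set_range label_top] .

lemma label_value: "x \<in> X \<Longrightarrow> label x = (i, j) \<Longrightarrow> f i j x = top_value x"
  using label_top[of x] by (auto simp: top_set_def)

text \<open>On \<open>K\<close> the maximum has a positive lower bound d. If all labels of block
  \<open>i\<close> occur on a set where each \<open>f i j\<close> varies by less than d, then every
  \<open>f i j\<close> is positive at any one point of it, against the zero sum.\<close>

lemma small_sets_proper:
  assumes K: "compact K" "K \<subseteq> X" and cont: "\<And>i j. i < n \<Longrightarrow> j < p \<Longrightarrow> continuous_on X (f i j)"
  shows "\<exists>e>0. \<forall>B. B \<noteq> {} \<longrightarrow> B \<subseteq> K \<longrightarrow> (\<forall>x\<in>B. \<forall>y\<in>B. dist x y < e) \<longrightarrow>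
           label ` B \<in> proper_label_sets p n"
proof (cases "K = {}")
  case True
  then show ?thesis by (intro exI[of _ 1]) auto
next
  case False
  let ?I = "{..<n} \<times> {..<p}"
  have n: "0 < n" using False K n_pos by auto
  have contK: "continuous_on K (f i j)" if "i < n" "j < p" for i j
    using cont[OF that] K(2) by (rule continuous_on_subset)
  have "\<exists>d>0. \<forall>x\<in>K. d \<le> top_value x"
  proof -
    have "continuous_on K top_value"
    proof -
      have "continuous_on K (\<lambda>x. Max ((\<lambda>(i, j). f i j x) ` I))" if "finite I" "I \<noteq> {}" "I \<subseteq> ?I" for I
        using that
      proof (induction I rule: finite_ne_induct)
        case (singleton a)
        then show ?case using contK by (cases a) auto
      next
        case (insert a I)
        have "continuous_on K (\<lambda>x. max (case a of (i, j) \<Rightarrow> f i j x) (Max ((\<lambda>(i, j). f i j x) ` I)))"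
          using insert contK by (intro continuous_on_max) (auto split: prod.splits)
        then show ?case using insert by (simp add: Max_insert)
      qed
      from this[of ?I] show ?thesis unfolding top_value_def[abs_def] using n p_gt_0 by auto
    qed
    then obtain x0 where "x0 \<in> K" "\<forall>x\<in>K. top_value x0 \<le> top_value x"
      using continuous_attains_inf[OF K(1) False] by blast
    then show ?thesis using top_value_pos K by blast
  qed
  then obtain d where d: "d > 0" "\<And>x. x \<in> K \<Longrightarrow> d \<le> top_value x" by blast
  have "\<exists>e>0. \<forall>x\<in>K. \<forall>y\<in>K. dist x y < e \<longrightarrow> dist (f i j x) (f i j y) < d" if "i < n" "j < p" for i j
    using compact_uniformly_continuous[OF contK[OF that] K(1)] d(1)
    unfolding uniformly_continuous_on_def by (metis dist_commute)
  then obtain e where e: "\<And>i j. i < n \<Longrightarrow> j < p \<Longrightarrow> e i j > 0"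
    "\<And>i j x y. i < n \<Longrightarrow> j < p \<Longrightarrow> x \<in> K \<Longrightarrow> y \<in> K \<Longrightarrow> dist x y < e i j \<Longrightarrow> dist (f i j x) (f i j y) < d"
    by metis
  define e0 where "e0 = Min ((\<lambda>(i, j). e i j) ` ?I)"
  have "e0 \<in> (\<lambda>(i, j). e i j) ` ?I"
    unfolding e0_def using n p_gt_0 by (intro Min_in) auto
  then obtain i0 j0 where "i0 < n" "j0 < p" "e0 = e i0 j0" by auto
  then have e0: "0 < e0" using e(1) by simp
  have e0_le: "e0 \<le> e i j" if "i < n" "j < p" for i j
    unfolding e0_def using that by (intro Min_le) auto
  show ?thesis
  proof (intro exI[of _ e0] conjI allI impI e0)
    fix B assume B: "B \<noteq> {}" "B \<subseteq> K" and small: "\<forall>x\<in>B. \<forall>y\<in>B. dist x y < e0"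
    obtain x where x: "x \<in> B" using B by auto
    have BX: "B \<subseteq> X" using B K by blast
    have range: "label ` B \<subseteq> {..<n} \<times> {..<p}" using BX label_range by blast
    have "(label ` B) `` {i} \<noteq> {..<p}" for i
    proof
      assume all: "(label ` B) `` {i} = {..<p}"
      then have "(i, 0) \<in> label ` B" using p_gt_0 by auto
      then have i: "i < n" using range by blast
      have pos: "f i j x > 0" if j: "j < p" for j
      proof -
        have "(i, j) \<in> label ` B" using all j by auto
        then obtain y where y: "y \<in> B" "label y = (i, j)" by (metis imageE)
        then have "y \<in> X" "y \<in> K" using BX B by blast+
        then have "f i j y \<ge> d" using label_value[OF _ y(2)] d(2)[of y] by simp
        moreover have "dist (f i j x) (f i j y) < d"
        proof (rule e(2)[OF i j])
          show "dist x y < e i j" using small x y(1) e0_le[OF i j] by (meson less_le_trans)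
        qed (use x y(1) B in blast)+
        ultimately show ?thesis by (simp add: dist_real_def)
      qed
      then have "(\<Sum>j<p. f i j x) > 0" using p_gt_0 by (intro sum_pos) auto
      then show False using f_sum[of x i] x BX i by (simp add: subsetD)
    qed
    then show "label ` B \<in> proper_label_sets p n"
      using B(1) range by (simp add: proper_label_sets_def)
  qed
qed

lemma no_equivariant_family:
  fixes v :: "nat \<Rightarrow> 'e" and m :: nat
  assumes g: "linear g" "g ^^ p = id" and m: "2 * m = (p - 1) * n"
    and cont: "\<And>i j. i < n \<Longrightarrow> j < p \<Longrightarrow> continuous_on X (f i j)"
    and hull: "\<And>J. convex hull (insert ((g ^^ J m) (v m)) (ladder_vertices g v J m)) \<subseteq> X"
  shows False
proof -
  define W where "W = (\<lambda>(i, j). (g ^^ j) (v i)) ` ({..m} \<times> {..<p})"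
  \<comment> \<open>The condition on the hull keeps subdivisions inside \<open>X\<close> and is
    stable under \<open>g\<close>.\<close>
  define \<L> where "\<L> k = {l. length l = k \<and> set l \<subseteq> W \<and> convex hull (set l) \<subseteq> X}" for k
  \<comment> \<open>A finite union of compact hulls that contains all vertices of all subdivisions,
    so a single mesh size \<open>e\<close> suffices.\<close>
  define K where "K = \<Union> ((hull) convex ` {B. B \<subseteq> W \<and> convex hull B \<subseteq> X})"
  define V where "V = proper_label_sets p n"
  define h where "h = (`) (shift_label p)"
  have W: "finite W" by (simp add: W_def)
  have in_W: "(g ^^ j) (v i) \<in> W" if "i \<le> m" for i j
  proof -
    have "(g ^^ j) (v i) = (g ^^ (j mod p)) (v i)"
      by (rule funpow_mod_eq[symmetric]) (simp add: g)
    then show ?thesis using that p_gt_0 by (auto simp: W_def)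
  qed
  have g_W: "g w \<in> W" if w: "w \<in> W" for w
  proof -
    obtain i j where "i \<le> m" "w = (g ^^ j) (v i)" using w by (auto simp: W_def)
    then show ?thesis using in_W[of i "Suc j"] by simp
  qed
  have K: "compact K" "K \<subseteq> X"
    unfolding K_def using W
    by (auto intro!: compact_Union finite_imp_compact_convex_hull intro: finite_subset)
  obtain e where e: "e > 0" and small: "\<And>B. B \<noteq> {} \<Longrightarrow> B \<subseteq> K \<Longrightarrow> (\<And>x y. x \<in> B \<Longrightarrow> y \<in> B \<Longrightarrow> dist x y < e)
      \<Longrightarrow> label ` B \<in> V"
    using small_sets_proper[OF K cont] unfolding V_def by metis
  define D where "D = diameter W"
  have D: "0 \<le> D" "\<And>x y. x \<in> W \<Longrightarrow> y \<in> W \<Longrightarrow> dist x y \<le> D"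
    unfolding D_def using W by (auto simp: diameter_ge_0 finite_imp_bounded diameter_bounded_bound)
  \<comment> \<open>The longest lists used have 2m + 1 entries, those of the top chain.\<close>
  define \<rho> where "\<rho> = 1 - 1 / real (2 * m + 1)"
  have \<rho>: "0 \<le> \<rho>" "\<rho> < 1" by (auto simp: \<rho>_def)
  have "(\<lambda>r. \<rho> ^ r * D) \<longlonglongrightarrow> 0 * D"
    by (intro tendsto_mult LIMSEQ_power_zero tendsto_const) (use \<rho> in auto)
  then have "eventually (\<lambda>r. \<rho> ^ r * D < e) sequentially"
    using e by (intro order_tendstoD) auto
  then obtain r where r: "\<rho> ^ r * D < e" by (auto simp: eventually_sequentially)
  define Sm where "Sm k = {l. length l = k \<and> set l \<subseteq> K \<and> (\<forall>x\<in>set l. \<forall>y\<in>set l. dist x y < e)}" for k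
  define sub where "sub = (subdivide ^^ r :: 'e chain \<Rightarrow> 'e chain)"
  have sub_Sm: "sub c \<in> chains_on (Sm k)" if c: "c \<in> chains_on (\<L> k)" and k: "k \<le> 2 * m + 1" for c k
  proof -
    have "sub c \<in> chains_on (\<Union>l\<in>\<L> k. small_in_hull (\<rho> ^ r * D) l)"
      unfolding sub_def \<rho>_def
      by (rule subdivide_iterated_mesh[OF c D(1)]) (use k D(2) in \<open>auto simp: \<L>_def\<close>)
    then show ?thesis
    proof (rule chains_mono, intro subsetI)
      fix l' assume "l' \<in> (\<Union>l\<in>\<L> k. small_in_hull (\<rho> ^ r * D) l)"
      then obtain l where l: "l \<in> \<L> k" "l' \<in> small_in_hull (\<rho> ^ r * D) l" by auto
      then have "convex hull (set l) \<subseteq> K" unfolding K_def \<L>_def by auto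
      then show "l' \<in> Sm k"
        using l unfolding Sm_def small_in_hull_def \<L>_def by (auto intro: le_less_trans[OF _ r])
    qed
  qed
  have sub_linear: "sub 0 = 0" "sub (a - b) = sub a - sub b" "sub (a + b) = sub a + sub b"
    "sub (frag_of []) = frag_of []" "boundary (sub a) = sub (boundary a)" for a b
    unfolding sub_def by (induction r) auto
  have sub_push: "sub (push g c) = push g (sub c)" for c
    unfolding sub_def
  proof (induction r)
    case (Suc r)
    have "subdivide (push g c) = push g (subdivide c)" for c
      by (rule push_refine[of UNIV]) (auto simp: barycenter_map[OF g(1)] chains_on_def)
    then show ?case using Suc by simp
  qed simp
  define \<beta> where "\<beta> l = label ` set l" for l
  \<comment> \<open>The chain map to flags: subdivide until simplices are small, replace each by the
    flags of its label sets, then discard degenerate flags.\<close>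
  define L where "L c = strict_part (refine \<beta> (sub c))" for c
  have L_linear: "L 0 = 0" "L (a - b) = L a - L b" "L (a + b) = L a + L b" "L (frag_of []) = frag_of []" for a b
    by (simp_all add: L_def sub_linear)
  have L_sum: "L (\<Sum>i\<in>I. c i) = (\<Sum>i\<in>I. L (c i))" for c and I :: "nat set"
    by (induction I rule: infinite_finite_induct) (auto simp: L_linear)
  have L_boundary: "boundary (L c) = L (boundary c)" for c
  proof -
    have "refine \<beta> (sub c) \<in> chains_on {l. sorted_wrt (\<ge>) l}"
      by (rule refine_sorted) (auto simp: \<beta>_def)
    then show ?thesis by (simp add: L_def boundary_strict_part sub_linear)
  qed
  have flag: "refine \<beta> c \<in> chains_on {l. set l \<subseteq> V \<and> length l = k}" if "c \<in> chains_on (Sm k)" for c k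
    unfolding refine_def
  proof (rule chains_frag_extend[OF that])
    fix l assume l: "l \<in> Sm k"
    have "refine \<beta> (frag_of l) \<in> chains_on {l'. set l' \<subseteq> {label ` B |B. B \<subseteq> set l \<and> B \<noteq> {}} \<and> length l' = length l}"
    proof (rule refine_support)
      show "\<beta> l \<in> {label ` B |B. B \<subseteq> set l \<and> B \<noteq> {}}" if "l \<noteq> []" for l
        using that by (auto simp: \<beta>_def)
      show "{label ` B |B. B \<subseteq> A \<and> B \<noteq> {}} \<subseteq> {label ` B |B. B \<subseteq> A' \<and> B \<noteq> {}}" if "A \<subseteq> A'" for A A'
        using that by blast
    qed
    moreover have sub: "{label ` B |B. B \<subseteq> set l \<and> B \<noteq> {}} \<subseteq> V"
    proof clarify
      fix B assume "B \<subseteq> set l" "B \<noteq> {}"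
      then show "label ` B \<in> V" using l by (intro small) (auto simp: Sm_def subset_iff)
    qed
    moreover have "length l = k" using l by (simp add: Sm_def)
    ultimately have "refine \<beta> (frag_of l) \<in> chains_on {l. set l \<subseteq> V \<and> length l = k}"
      using order_trans[OF _ sub] by (elim chains_mono) blast
    then show "refine_list \<beta> (length l) l \<in> chains_on {l. set l \<subseteq> V \<and> length l = k}"
      by (simp add: refine_def)
  qed
  have strict: "strict_part c \<in> chains_on {l. sorted_wrt (>) l \<and> l \<in> \<M>}" if "c \<in> chains_on \<M>" for c \<M>
    unfolding strict_part_def using that by (rule chains_frag_extend) auto
  have L_strict: "L c \<in> chains_on {l. sorted_wrt (>) l \<and> set l \<subseteq> V \<and> length l = k}"
    if "c \<in> chains_on (\<L> k)" "k \<le> 2 * m + 1" for c k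
    using strict[OF flag[OF sub_Sm[OF that]]] by (simp add: L_def)
  then have L_V: "L c \<in> chains_on {l. set l \<subseteq> V \<and> length l = k}"
    if "c \<in> chains_on (\<L> k)" "k \<le> 2 * m + 1" for c k
    using that by (blast intro: chains_mono)
  have V_sub: "A \<subseteq> {..<n} \<times> {..<p}" "A \<noteq> {}" if "A \<in> V" for A
    using that by (auto simp: V_def proper_label_sets_def)
  have V_finite: "finite A" if "A \<in> V" for A
    using V_sub(1)[OF that] by (rule finite_subset) simp
  have h_less: "h A < h B \<longleftrightarrow> A < B" if "A \<in> V" "B \<in> V" for A B
    using V_sub[OF that(1)] V_sub[OF that(2)] inj_on_shift_label[of p n]
    unfolding h_def less_le_not_le by (simp add: inj_on_image_subset_iff)
  have L_push: "L (push g c) = push h (L c)" if c: "c \<in> chains_on (\<L> k)" and k: "k \<le> 2 * m + 1" for c k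
  proof -
    have s: "sub c \<in> chains_on (Sm k)" using sub_Sm that by blast
    have "refine \<beta> (push g (sub c)) = push h (refine \<beta> (sub c))"
    proof (rule push_refine[of X])
      show "\<beta> (map g l) = h (\<beta> l)" if "set l \<subseteq> X" for l
        using that by (auto simp: \<beta>_def h_def image_image label_g subset_iff intro!: image_cong)
      show "sub c \<in> chains_on {l. set l \<subseteq> X}"
        using s by (rule chains_mono) (use K in \<open>auto simp: Sm_def\<close>)
    qed
    moreover have "strict_part (push h (refine \<beta> (sub c))) = push h (strict_part (refine \<beta> (sub c)))"
      by (rule push_strict_part[of V, OF h_less]) (use flag[OF s] in \<open>auto elim: chains_mono\<close>)
    ultimately show ?thesis by (simp add: L_def sub_push)
  qed
  have push_\<L>: "push g c \<in> chains_on (\<L> k)" if "c \<in> chains_on (\<L> k)" for c k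
    using that
  proof (rule chains_push)
    fix l assume "l \<in> \<L> k"
    then show "map g l \<in> \<L> k"
      using g_W g_X by (auto simp: \<L>_def convex_hull_linear_image[OF g(1), symmetric] subset_iff)
  qed
  have push_Suc: "push (k ^^ Suc j) c = push k (push (k ^^ j) c)" for k :: "'x \<Rightarrow> 'x" and j c
    by (simp add: comp_def)
  have L_push_funpow: "push (g ^^ j) c \<in> chains_on (\<L> k) \<and> L (push (g ^^ j) c) = push (h ^^ j) (L c)"
    if c: "c \<in> chains_on (\<L> k)" and k: "k \<le> 2 * m + 1" for c k j
  proof (induction j)
    case 0
    show ?case using c by (simp flip: id_def)
  next
    case (Suc j)
    then show ?case
      unfolding push_Suc using push_\<L> L_push[OF _ k] by (simp del: push_push)
  qed
  have L_norm: "L (norm_chain p g c) = norm_chain p h (L c)"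
    if "c \<in> chains_on (\<L> k)" "k \<le> 2 * m + 1" for c k
    unfolding norm_chain_def L_sum using L_push_funpow[OF that] by simp

  interpret free_cyclic_action p h V "label_index p"
  proof
    show "label_index p (h A) = Suc (label_index p A) mod p" if "A \<in> V" for A
      using that label_index_shift[OF prime_p] by (auto simp: h_def V_def)
  qed (auto simp: p_gt_0 label_index_less h_def V_def shift_label_closed shift_label_order)

  define z where "z = ladder_cycle p g v"
  define c where "c k = cone_chain (v k) (z k)" for k
  define d where "d k = cone_chain (v k) (cone_chain (g (v k)) (z k))" for k
  have z: "boundary (z k) = 0" "push g (z k) = z k" for k
    using ladder_cycle_properties[OF g(2)] by (auto simp: z_def)
  \<comment> \<open>For k < m both ends of an edge of polygon \<open>k\<close> already occur in the
    ladder simplex; for k = m only one translate of \<open>v m\<close> is allowed, since different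
    translates lie on different bisectors.\<close>
  have support: "l \<in> \<L> (length l)"
    if "set l \<subseteq> insert ((g ^^ J k) (v k)) (insert ((g ^^ Suc (J k)) (v k)) (ladder_vertices g v J k))"
      "k \<le> m" "k = m \<Longrightarrow> set l \<subseteq> insert ((g ^^ J m) (v m)) (ladder_vertices g v J m)" for l k J
  proof -
    have lv: "ladder_vertices g v J m \<subseteq> W"
      using in_W unfolding ladder_vertices_def by (force simp del: funpow.simps)
    have "ladder_vertices g v J (Suc k) \<subseteq> ladder_vertices g v J m" if "k \<noteq> m"
      unfolding ladder_vertices_def using \<open>k \<le> m\<close> that by (intro UN_mono) auto
    then have sub: "set l \<subseteq> insert ((g ^^ J m) (v m)) (ladder_vertices g v J m)"
      using that by (cases "k = m") (auto simp: ladder_vertices_def lessThan_Suc)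
    then have "convex hull (set l) \<subseteq> X" using hull[of J] hull_mono by blast
    then show ?thesis using sub lv in_W[of m] by (auto simp: \<L>_def)
  qed
  have z_supp: "z k \<in> chains_on {l. length l = 2 * k \<and> (\<exists>J. set l \<subseteq> ladder_vertices g v J k)}" for k
    unfolding z_def by (rule ladder_cycle_support)
  \<comment> \<open>Edge number \<open>k\<close> does not affect the first \<open>k\<close>
    polygons, so it may be set to 0, where the edge begins at \<open>v k\<close>.\<close>
  have upd: "ladder_vertices g v (J(k := 0)) k = ladder_vertices g v J k" for J k
    by (auto simp: ladder_vertices_def)
  have c_supp: "c k \<in> chains_on (\<L> (2 * k + 1))" if "k \<le> m" for k
    unfolding c_def
  proof (rule chains_cone[OF z_supp])
    fix l assume "l \<in> {l. length l = 2 * k \<and> (\<exists>J. set l \<subseteq> ladder_vertices g v J k)}"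
    then obtain J where "length l = 2 * k" "set l \<subseteq> ladder_vertices g v J k" by auto
    then show "v k # l \<in> \<L> (2 * k + 1)"
      using support[of "v k # l" "J(k := 0)" k] that by (force simp: upd)
  qed
  have d_supp: "d k \<in> chains_on (\<L> (2 * k + 2))" if "k < m" for k
    unfolding d_def
  proof (rule chains_cone[OF chains_cone[OF z_supp]])
    show "g (v k) # l \<in> {g (v k) # l |l. length l = 2 * k \<and> (\<exists>J. set l \<subseteq> ladder_vertices g v J k)}"
      if "l \<in> {l. length l = 2 * k \<and> (\<exists>J. set l \<subseteq> ladder_vertices g v J k)}" for l
      using that by auto
    fix l assume "l \<in> {g (v k) # l |l. length l = 2 * k \<and> (\<exists>J. set l \<subseteq> ladder_vertices g v J k)}"
    then obtain l' J where "l = g (v k) # l'" "length l' = 2 * k" "set l' \<subseteq> ladder_vertices g v J k" by auto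
    then show "v k # l \<in> \<L> (2 * k + 2)"
      using support[of "v k # l" "J(k := 0)" k] that by (force simp: upd)
  qed
  have "L (c m) \<noteq> 0"
  proof (rule no_ladder[where Z = "\<lambda>k. L (z k)" and C = "\<lambda>k. L (c k)" and D = "\<lambda>k. L (d k)" and m = m])
    show "1 < p" using prime_p prime_gt_1_nat by blast
    show "L (z 0) = frag_of []" by (simp add: z_def L_linear)
    show "boundary (L (c k)) = L (z k)" if "k \<le> m" for k
      by (simp add: L_boundary c_def z)
    show "boundary (L (d k)) = push h (L (c k)) - L (c k)" if "k < m" for k
    proof -
      have "boundary (d k) = push g (c k) - c k" by (simp add: d_def c_def z)
      then show ?thesis using L_push[OF c_supp] that by (simp add: L_boundary L_linear)
    qed
    show "L (z (Suc k)) = norm_chain p h (L (d k))" if "k < m" for k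
      using L_norm[OF d_supp[OF that]] that by (simp add: z_def d_def)
    show "L (c k) \<in> chains_on (simplices (2 * k + 1))" if "k \<le> m" for k
      using L_V[OF c_supp[OF that]] that by simp
    show "L (d k) \<in> chains_on (simplices (2 * k + 2))" if "k < m" for k
      using L_V[OF d_supp[OF that]] that by simp
  qed
  moreover have "L (c m) \<in> chains_on {l. sorted_wrt (>) l \<and> set l \<subseteq> V \<and> length l = 2 * m + 1}"
    using L_strict[OF c_supp] by simp
  moreover have "{l. sorted_wrt (>) l \<and> set l \<subseteq> V \<and> length l = 2 * m + 1} = {}"
  proof -
    \<comment> \<open>A strict flag is no longer than its largest set, which has at most (p - 1) n =
      2m elements.\<close>
    have "length l \<noteq> 2 * m + 1" if l: "sorted_wrt (>) l" "set l \<subseteq> V" for l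
    proof
      assume len: "length l = 2 * m + 1"
      then have ne: "l \<noteq> []" by auto
      have "length l \<le> card (hd l)"
        using l ne V_sub V_finite by (intro strictly_decreasing_sets_length) auto
      also have "\<dots> \<le> (p - 1) * n"
        using l ne by (intro card_proper_label_set) (auto simp: V_def)
      finally show False using len m by simp
    qed
    then show ?thesis by auto
  qed
  ultimately show False by (simp only: chains_on_def mem_Collect_eq subset_empty keys_eq_empty)
qed

end

section \<open>Signed measures\<close>

lemma signed_sums:
  assumes "finite_signed_borel_measure \<mu>" "\<And>j::nat. A j \<in> sets borel" "disjoint_family A"
  shows "(\<lambda>j. \<mu> (A j)) sums \<mu> (\<Union>j. A j)"
  using assms unfolding finite_signed_borel_measure_def by (simp add: image_subset_iff)

lemma signed_Un:
  assumes \<mu>: "finite_signed_borel_measure \<mu>" and "A \<in> sets borel" "B \<in> sets borel" "A \<inter> B = {}"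
  shows "\<mu> (A \<union> B) = \<mu> A + \<mu> B"
proof -
  have "(\<lambda>j. \<mu> (binaryset A B j)) sums \<mu> (\<Union>j. binaryset A B j)"
  proof (rule signed_sums[OF \<mu>])
    show "disjoint_family (binaryset A B)"
      using assms(4) by (auto simp: disjoint_family_on_def binaryset_def)
  qed (use assms in \<open>auto simp: binaryset_def\<close>)
  moreover have "(\<lambda>j. \<mu> (binaryset A B j)) sums (\<mu> A + \<mu> B)"
    by (rule binaryset_sums) (use \<mu> in \<open>simp add: finite_signed_borel_measure_def\<close>)
  ultimately show ?thesis by (simp add: UN_binaryset_eq sums_unique2)
qed

lemma signed_Diff:
  assumes "finite_signed_borel_measure \<mu>" "A \<in> sets borel" "B \<in> sets borel" "A \<subseteq> B"
  shows "\<mu> (B - A) = \<mu> B - \<mu> A"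
  using signed_Un[OF assms(1,2), of "B - A"] assms by (simp add: Un_absorb1)

lemma signed_UN_lessThan:
  fixes k :: nat
  assumes \<mu>: "finite_signed_borel_measure \<mu>"
    and A: "\<And>j. j < k \<Longrightarrow> A j \<in> sets borel" "disjoint_family_on A {..<k}"
  shows "\<mu> (\<Union>j<k. A j) = (\<Sum>j<k. \<mu> (A j))"
  using A
proof (induction k)
  case 0
  then show ?case using \<mu> by (simp add: finite_signed_borel_measure_def)
next
  case (Suc k)
  have "(\<Union>j<k. A j) \<inter> A k = {}"
  proof -
    have "A j \<inter> A k = {}" if "j < k" for j
      using disjoint_family_onD[OF Suc.prems(2), of j k] that by auto
    then show ?thesis by blast
  qed
  moreover have "disjoint_family_on A {..<k}"
    using Suc.prems(2) by (rule disjoint_family_on_mono[rotated]) auto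
  ultimately have "\<mu> ((\<Union>j<k. A j) \<union> A k) = (\<Sum>j<k. \<mu> (A j)) + \<mu> (A k)"
    using Suc by (subst signed_Un[OF \<mu>]) auto
  then show ?case by (simp add: lessThan_Suc Un_commute)
qed

text \<open>Signed measures are not monotone, so the limit comes from telescoping over the disjoint
  shells between consecutive sets.\<close>

lemma signed_decseq_empty:
  assumes \<mu>: "finite_signed_borel_measure \<mu>" and G: "\<And>j. G j \<in> sets borel" "decseq G" "(\<Inter>j. G j) = {}"
  shows "(\<lambda>j. \<mu> (G j)) \<longlonglongrightarrow> 0"
proof -
  let ?D = "\<lambda>j. G j - G (Suc j)"
  have G_anti: "G j \<subseteq> G i" if "i \<le> j" for i j using G(2) that by (simp add: decseqD)
  have "(\<lambda>j. \<mu> (?D j)) sums \<mu> (\<Union>j. ?D j)"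
  proof (rule signed_sums[OF \<mu>])
    have "?D i \<inter> ?D j = {}" if "i < j" for i j
      using G_anti[of "Suc i" j] that by auto
    then show "disjoint_family ?D"
      unfolding disjoint_family_on_def by (metis Int_commute linorder_neqE_nat)
  qed (use G in auto)
  moreover have "(\<Union>j. ?D j) = G 0"
  proof (intro equalityI subsetI)
    fix x assume x: "x \<in> G 0"
    obtain j where "x \<notin> G j" using G(3) by auto
    then have "(LEAST j. x \<notin> G j) \<noteq> 0" "x \<notin> G (LEAST j. x \<notin> G j)"
      using x by (metis LeastI)+
    then obtain i where i: "(LEAST j. x \<notin> G j) = Suc i" by (cases "LEAST j. x \<notin> G j") auto
    then have "x \<in> G i" using not_less_Least[of i "\<lambda>j. x \<notin> G j"] by auto
    then show "x \<in> (\<Union>j. ?D j)" using i \<open>x \<notin> G (LEAST j. x \<notin> G j)\<close> by auto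
  qed (use G_anti[of 0] in auto)
  ultimately have "(\<lambda>k. \<Sum>j<k. \<mu> (?D j)) \<longlonglongrightarrow> \<mu> (G 0)" by (simp add: sums_def)
  moreover have "(\<Sum>j<k. \<mu> (?D j)) = \<mu> (G 0) - \<mu> (G k)" for k
    using G_anti by (induction k) (auto simp: signed_Diff[OF \<mu>] G)
  ultimately have "(\<lambda>k. \<mu> (G 0) - \<mu> (G k)) \<longlonglongrightarrow> \<mu> (G 0)" by simp
  then have "(\<lambda>k. \<mu> (G 0) - (\<mu> (G 0) - \<mu> (G k))) \<longlonglongrightarrow> \<mu> (G 0) - \<mu> (G 0)"
    by (intro tendsto_diff tendsto_const)
  then show ?thesis by simp
qed

text \<open>Without a Hahn decomposition: otherwise a subsequence yields disjoint sets whose measures stay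
  away from 0.\<close>

lemma signed_subsets_decseq_empty:
  assumes \<mu>: "finite_signed_borel_measure \<mu>" and B: "\<And>j. B j \<in> sets borel" "decseq B" "(\<Inter>j. B j) = {}"
    and C: "\<And>j. C j \<in> sets borel" "\<And>j. C j \<subseteq> B j"
  shows "(\<lambda>j. \<mu> (C j)) \<longlonglongrightarrow> 0"
proof (rule ccontr)
  assume "\<not> ?thesis"
  then obtain e where e: "e > 0" and big: "\<And>N. \<exists>j\<ge>N. \<bar>\<mu> (C j)\<bar> \<ge> e"
    by (auto simp: LIMSEQ_iff not_less)
  \<comment> \<open>For fixed \<open>j\<close> the sets \<open>C j \<inter> B k\<close> shrink to
    the empty set, so removing a late \<open>B k\<close> from \<open>C j\<close> costs less than
    half of \<open>e\<close>.\<close>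
  have step: "\<exists>k. k > j \<and> \<bar>\<mu> (C k)\<bar> \<ge> e \<and> \<bar>\<mu> (C j \<inter> B k)\<bar> < e / 2" for j
  proof -
    have "(\<lambda>k. \<mu> (C j \<inter> B k)) \<longlonglongrightarrow> 0"
      by (rule signed_decseq_empty[OF \<mu>]) (use B C in \<open>auto simp: decseq_def\<close>)
    then obtain N where N: "\<And>k. k \<ge> N \<Longrightarrow> \<bar>\<mu> (C j \<inter> B k)\<bar> < e / 2"
      using e unfolding LIMSEQ_iff by (metis diff_zero half_gt_zero real_norm_def)
    obtain k where "k \<ge> max N (Suc j)" "\<bar>\<mu> (C k)\<bar> \<ge> e" using big by blast
    then show ?thesis using N by (intro exI[of _ k]) auto
  qed
  obtain j0 where j0: "\<bar>\<mu> (C j0)\<bar> \<ge> e" using big by blast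
  have "\<exists>s. \<forall>i. \<bar>\<mu> (C (s i))\<bar> \<ge> e \<and> (s (Suc i) > s i \<and> \<bar>\<mu> (C (s i) \<inter> B (s (Suc i)))\<bar> < e / 2)"
    by (rule dependent_nat_choice[where P = "\<lambda>_ j. \<bar>\<mu> (C j)\<bar> \<ge> e"
          and Q = "\<lambda>_ j k. k > j \<and> \<bar>\<mu> (C j \<inter> B k)\<bar> < e / 2"]) (use j0 step in blast)+
  then obtain s where s: "\<And>i. \<bar>\<mu> (C (s i))\<bar> \<ge> e" "\<And>i. s (Suc i) > s i"
    "\<And>i. \<bar>\<mu> (C (s i) \<inter> B (s (Suc i)))\<bar> < e / 2" by blast
  have "strict_mono s" by (simp add: strict_mono_Suc_iff s)
  \<comment> \<open>Later sets \<open>C (s j)\<close> lie inside \<open>B (s (Suc i))\<close>, so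
    the \<open>D i\<close> are disjoint; each has measure above e / 2 in absolute value, against
    summability.\<close>
  define D where "D i = C (s i) - B (s (Suc i))" for i
  have "(\<lambda>i. \<mu> (D i)) sums \<mu> (\<Union>i. D i)"
  proof (rule signed_sums[OF \<mu>])
    have "D i \<inter> D j = {}" if "i < j" for i j
    proof -
      have "B (s j) \<subseteq> B (s (Suc i))"
        using that \<open>strict_mono s\<close> by (intro decseqD[OF B(2)]) (simp add: strict_mono_less_eq Suc_le_eq)
      then show ?thesis using C(2)[of "s j"] by (auto simp: D_def)
    qed
    then show "disjoint_family D"
      unfolding disjoint_family_on_def by (metis Int_commute linorder_neqE_nat)
  qed (use B C in \<open>auto simp: D_def\<close>)
  then have "(\<lambda>i. \<mu> (D i)) \<longlonglongrightarrow> 0" using sums_summable summable_LIMSEQ_zero by blast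
  then obtain i where "\<bar>\<mu> (D i)\<bar> < e / 2"
    using e unfolding LIMSEQ_iff by (metis diff_zero half_gt_zero real_norm_def order_refl)
  moreover have "\<mu> (D i) = \<mu> (C (s i)) - \<mu> (C (s i) \<inter> B (s (Suc i)))"
  proof -
    have "D i = C (s i) - C (s i) \<inter> B (s (Suc i))" by (auto simp: D_def)
    then show ?thesis using signed_Diff[OF \<mu>, of "C (s i) \<inter> B (s (Suc i))" "C (s i)"] B C by simp
  qed
  ultimately show False using s(1,3)[of i] by linarith
qed

text \<open>Outside \<open>H\<close>, the differences between \<open>A j\<close> and
  \<open>A'\<close> lie in the tails \<open>B j\<close>, which decrease to the empty set by
  pointwise convergence.\<close>

lemma signed_tendsto:
  assumes \<mu>: "finite_signed_borel_measure \<mu>"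
    and A: "\<And>j. A j \<in> sets borel" "A' \<in> sets borel" and H: "H \<in> sets borel"
    and null: "\<And>E. E \<in> sets borel \<Longrightarrow> E \<subseteq> H \<Longrightarrow> \<mu> E = 0"
    and conv: "\<And>x. x \<notin> H \<Longrightarrow> eventually (\<lambda>j. x \<in> A j \<longleftrightarrow> x \<in> A') sequentially"
  shows "(\<lambda>j. \<mu> (A j)) \<longlonglongrightarrow> \<mu> A'"
proof -
  define B where "B j = (\<Union>k\<in>{j..}. (A k - A') \<union> (A' - A k)) - H" for j
  have B: "B j \<in> sets borel" for j
    unfolding B_def using A H by (intro sets.Diff sets.countable_UN') auto
  have decB: "decseq B" unfolding decseq_def B_def by (auto intro: order_trans)
  have "(\<Inter>j. B j) = {}"
  proof (rule ccontr)
    assume "(\<Inter>j. B j) \<noteq> {}"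
    then obtain x where x: "\<And>j. x \<in> B j" by auto
    then have "x \<notin> H" by (auto simp: B_def)
    then obtain N where "\<And>k. k \<ge> N \<Longrightarrow> x \<in> A k \<longleftrightarrow> x \<in> A'"
      using conv by (auto simp: eventually_sequentially)
    then show False using x[of N] by (auto simp: B_def)
  qed
  note lim = signed_subsets_decseq_empty[OF \<mu> B decB this]
  have minus_H: "\<mu> (E - H) = \<mu> E" if "E \<in> sets borel" for E
  proof -
    have "E - H = E - E \<inter> H" by auto
    then show ?thesis
      using signed_Diff[OF \<mu>, of "E \<inter> H" E] null[of "E \<inter> H"] that H by simp
  qed
  have "(\<lambda>j. \<mu> (A j - A' - H)) \<longlonglongrightarrow> 0" "(\<lambda>j. \<mu> (A' - A j - H)) \<longlonglongrightarrow> 0"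
    by (rule lim; use A H in \<open>force simp: B_def\<close>)+
  then have "(\<lambda>j. \<mu> A' + \<mu> (A j - A') - \<mu> (A' - A j)) \<longlonglongrightarrow> \<mu> A' + 0 - 0"
    using A by (intro tendsto_intros) (simp_all add: minus_H)
  moreover have "\<mu> (A j) = \<mu> A' + \<mu> (A j - A') - \<mu> (A' - A j)" for j
  proof -
    have "A j - A' = A j - A j \<inter> A'" "A' - A j = A' - A j \<inter> A'" by auto
    then show ?thesis
      using signed_Diff[OF \<mu>, of "A j \<inter> A'" "A j"] signed_Diff[OF \<mu>, of "A j \<inter> A'" A'] A by simp
  qed
  ultimately show ?thesis by simp
qed

section \<open>Sectors of the plane\<close>

text \<open>Angles are measured in units of 2 pi / p, so walls are at integers, bisectors at
  half-integers, and \<open>s\<close> matters only modulo \<open>p\<close>.\<close>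

definition wedge :: "nat \<Rightarrow> nat \<Rightarrow> complex set" where
  "wedge p j = {rcis r (2 * pi * s / real p) | r s. 0 \<le> r \<and> real j \<le> s \<and> s \<le> real j + 1}"

definition walls :: "nat \<Rightarrow> complex set" where
  "walls p = {rcis r (2 * pi * real k / real p) | r k. 0 \<le> r \<and> k < p}"

lemma rcis_periodic:
  assumes "0 < p"
  shows "rcis r (2 * pi * (s + real p * of_int z) / real p) = rcis r (2 * pi * s / real p)"
proof -
  have "2 * pi * (s + real p * of_int z) / real p = 2 * pi * s / real p + 2 * pi * of_int z"
    using assms by (simp add: field_simps)
  then show ?thesis by (simp add: rcis_def cis_mult[symmetric])
qed

lemma rcis_eq_rcis:
  assumes p: "0 < p" and "0 < r" "0 \<le> r'"
    and eq: "rcis r (2 * pi * s / real p) = rcis r' (2 * pi * s' / real p)"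
  obtains z :: int where "s = s' + real p * of_int z"
proof -
  have "\<bar>r\<bar> = \<bar>r'\<bar>" using arg_cong[OF eq, of cmod] by (simp only: complex_mod_rcis)
  then have "r = r'" using assms by simp
  then have "cis (2 * pi * s / real p) = cis (2 * pi * s' / real p)"
    using eq assms by (simp add: rcis_def)
  then obtain z :: int where "\<i> * of_real (2 * pi * s / real p) =
      \<i> * of_real (2 * pi * s' / real p) + (of_int (2 * z) * pi) * \<i>"
    unfolding cis_conv_exp exp_eq by blast
  then have "2 * pi * s / real p = 2 * pi * s' / real p + of_int (2 * z) * pi"
    by (auto simp: complex_eq_iff)
  then have "(2 * pi) * s = (2 * pi) * (s' + real p * of_int z)" using p by (simp add: field_simps)
  then have "s = s' + real p * of_int z" by simp
  then show thesis by (rule that)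
qed

lemma rcis_in_walls:
  assumes "0 < p" "0 \<le> r"
  shows "rcis r (2 * pi * real k / real p) \<in> walls p"
proof -
  have "real k = real (k mod p) + real p * of_int (int (k div p))"
    by (metis mod_mult_div_eq of_int_of_nat_eq of_nat_add of_nat_mult)
  then have "rcis r (2 * pi * real k / real p) = rcis r (2 * pi * real (k mod p) / real p)"
    using rcis_periodic[OF assms(1), of r "real (k mod p)" "int (k div p)"] by simp
  then show ?thesis
    using assms unfolding walls_def by (intro CollectI exI[of _ r] exI[of _ "k mod p"]) auto
qed

lemma wedge_cover:
  assumes p: "0 < p"
  obtains j where "j < p" "z \<in> wedge p j"
proof -
  define s where "s = real p * Arg2pi z / (2 * pi)"
  have s: "0 \<le> s" "s < real p"
    using p Arg2pi_ge_0[of z] Arg2pi_lt_2pi[of z] by (auto simp: s_def field_simps)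
  have "z = rcis (cmod z) (2 * pi * s / real p)"
    using Arg2pi_eq[of z] p by (simp add: s_def rcis_def cis_conv_exp)
  moreover have "real (nat \<lfloor>s\<rfloor>) \<le> s" "s \<le> real (nat \<lfloor>s\<rfloor>) + 1" using s by linarith+
  ultimately have "z \<in> wedge p (nat \<lfloor>s\<rfloor>)"
    unfolding wedge_def by (intro CollectI exI[of _ "cmod z"] exI[of _ s]) auto
  moreover have "nat \<lfloor>s\<rfloor> < p" using s by linarith
  ultimately show thesis using that by blast
qed

lemma wedge_off_walls:
  assumes p: "0 < p" and z: "z \<in> wedge p j" "z \<notin> walls p"
  obtains r s where "0 < r" "real j < s" "s < real j + 1" "z = rcis r (2 * pi * s / real p)"
proof -
  obtain r s where rs: "z = rcis r (2 * pi * s / real p)" "0 \<le> r" "real j \<le> s" "s \<le> real j + 1"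
    using z(1) by (auto simp: wedge_def)
  have "r \<noteq> 0" using z(2) rs rcis_in_walls[OF p, of 0 0] by auto
  moreover have "s \<noteq> real j" using z(2) rs rcis_in_walls[OF p, of r j] by auto
  moreover have "s \<noteq> real j + 1" using z(2) rs rcis_in_walls[OF p, of r "Suc j"] by (auto simp: add.commute)
  ultimately show thesis using rs by (intro that[OF _ _ _ rs(1)]) auto
qed

lemma wedge_unique:
  assumes p: "0 < p" and z: "z \<notin> walls p" "z \<in> wedge p j" "z \<in> wedge p k" and jk: "j < p" "k < p"
  shows "j = k"
proof -
  obtain r s where rs: "0 < r" "real j < s" "s < real j + 1" "z = rcis r (2 * pi * s / real p)"
    using wedge_off_walls[OF p z(2,1)] by blast
  obtain r' s' where rs': "0 < r'" "real k < s'" "s' < real k + 1" "z = rcis r' (2 * pi * s' / real p)"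
    using wedge_off_walls[OF p z(3,1)] by blast
  obtain q :: int where q: "s = s' + real p * of_int q"
    using rcis_eq_rcis[OF p rs(1), of r' s s'] rs rs' by auto
  have q': "s = s' + of_int (int p * q)" using q by simp
  have "int j = \<lfloor>s\<rfloor>" "int k = \<lfloor>s'\<rfloor>" using rs rs' by linarith+
  then have jq: "int j = int k + int p * q" by (simp only: q' floor_add_int)
  have "q = 0"
  proof (rule ccontr)
    assume "q \<noteq> 0"
    then have "int p * \<bar>q\<bar> \<ge> int p" using p by simp
    then have "\<bar>int p * q\<bar> \<ge> int p" by (simp add: abs_mult)
    then show False using jq jk by linarith
  qed
  then show ?thesis using jq by simp
qed

text \<open>The set is a cone over a compact set that avoids the origin.\<close>

lemma closed_rays:
  assumes "compact S"
  shows "closed {rcis r (2 * pi * s / real p) | r s. 0 \<le> r \<and> s \<in> S}"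
proof -
  let ?f = "\<lambda>s. cis (2 * pi * s / real p)"
  have "compact (?f ` S)"
    using assms by (intro compact_continuous_image) (auto intro!: continuous_intros simp: divide_inverse)
  moreover have "0 \<notin> ?f ` S" by auto
  ultimately have "closed (conic hull (?f ` S))" by (blast intro: closed_conic_hull)
  also have "conic hull (?f ` S) = {rcis r (2 * pi * s / real p) | r s. 0 \<le> r \<and> s \<in> S}"
    unfolding conic_hull_explicit rcis_def scaleR_conv_of_real by blast
  finally show ?thesis .
qed

lemma closed_wedge: "closed (wedge p j)"
  using closed_rays[of "{real j..real j + 1}" p] by (simp add: wedge_def)

lemma closed_walls: "closed (walls p)"
proof -
  have "walls p = {rcis r (2 * pi * s / real p) | r s. 0 \<le> r \<and> s \<in> real ` {..<p}}"
    unfolding walls_def by blast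
  then show ?thesis using closed_rays[of "real ` {..<p}" p] by (simp add: finite_imp_compact)
qed

text \<open>Off the walls exactly one wedge contains \<open>z\<close>; the complement of the other
  finitely many closed wedges is an open neighbourhood of \<open>z\<close> inside it.\<close>

lemma eventually_wedge:
  assumes p: "0 < p" and z: "z \<notin> walls p" and j: "j < p" and lim: "(y \<longlongrightarrow> z) F"
  shows "eventually (\<lambda>x. y x \<in> wedge p j \<longleftrightarrow> z \<in> wedge p j) F"
proof -
  obtain k where k: "k < p" "z \<in> wedge p k" using wedge_cover[OF p] by blast
  define U where "U = - (\<Union>i\<in>{..<p} - {k}. wedge p i)"
  have "open U" unfolding U_def by (intro open_Compl closed_UN) (auto simp: closed_wedge)
  moreover have "z \<in> U" using wedge_unique[OF p z _ k(2) _ k(1)] by (auto simp: U_def)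
  ultimately have "eventually (\<lambda>x. y x \<in> U) F" using lim by (rule topological_tendstoD[rotated])
  moreover have "z' \<in> wedge p j \<longleftrightarrow> z \<in> wedge p j" if "z' \<in> U" for z'
  proof -
    have "z' \<in> wedge p k"
      using wedge_cover[OF p, of z'] that by (auto simp: U_def)
    then show ?thesis
      using that k j \<open>z \<in> U\<close> by (cases "j = k") (auto simp: U_def)
  qed
  ultimately show ?thesis by (rule eventually_mono)
qed

lemma rcis_mid_notin_walls:
  assumes p: "0 < p" and r: "0 < r"
  shows "rcis r (2 * pi * (real k + 1/2) / real p) \<notin> walls p"
proof
  assume "rcis r (2 * pi * (real k + 1/2) / real p) \<in> walls p"
  then obtain r' k' where "0 \<le> r'"
    "rcis r (2 * pi * (real k + 1/2) / real p) = rcis r' (2 * pi * real k' / real p)"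
    by (auto simp: walls_def)
  then obtain z :: int where "real k + 1/2 = real k' + real p * of_int z"
    using rcis_eq_rcis[OF p r] by blast
  then have "real_of_int (2 * int k + 1) = real_of_int (2 * (int k' + int p * z))" by simp
  then have "2 * int k + 1 = 2 * (int k' + int p * z)" unfolding of_int_eq_iff .
  then show False by presburger
qed

lemma wedge_shift:
  assumes p: "0 < p" and j: "j < p"
  shows "cis (2 * pi / real p) * z \<in> wedge p (cyc p j) \<longleftrightarrow> z \<in> wedge p j"
proof -
  have rot: "cis (2 * pi / real p) * rcis r (2 * pi * s / real p) = rcis r (2 * pi * (s + 1) / real p)" for r s
  proof -
    have "2 * pi * (s + 1) / real p = 2 * pi / real p + 2 * pi * s / real p"
      by (simp add: field_simps add_divide_distrib)
    then show ?thesis by (simp add: rcis_def cis_mult[symmetric])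
  qed
  \<comment> \<open>Needed for the wrap-around from the last wedge to wedge 0.\<close>
  have down: "rcis r (2 * pi * (s - real p) / real p) = rcis r (2 * pi * s / real p)" for r s
    using rcis_periodic[OF p, of r s "-1"] by simp
  have last: "real j = real p - 1" if "Suc j = p" using that by auto
  show ?thesis
  proof
    assume "z \<in> wedge p j"
    then obtain r s where rs: "z = rcis r (2 * pi * s / real p)" "0 \<le> r" "real j \<le> s" "s \<le> real j + 1"
      by (auto simp: wedge_def)
    then have z: "cis (2 * pi / real p) * z = rcis r (2 * pi * (s + 1) / real p)" by (simp add: rot)
    show "cis (2 * pi / real p) * z \<in> wedge p (cyc p j)"
    proof (cases "Suc j = p")
      case True
      have "cis (2 * pi / real p) * z = rcis r (2 * pi * (s + 1 - real p) / real p)"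
        unfolding z by (simp only: down)
      then show ?thesis
        using rs last[OF True] True unfolding wedge_def cyc_def
        by (intro CollectI exI[of _ r] exI[of _ "s + 1 - real p"]) auto
    next
      case False
      then have "cyc p j = Suc j" using j by (simp add: cyc_def)
      then show ?thesis
        using rs z unfolding wedge_def by (intro CollectI exI[of _ r] exI[of _ "s + 1"]) auto
    qed
  next
    assume "cis (2 * pi / real p) * z \<in> wedge p (cyc p j)"
    then obtain r s where rs: "cis (2 * pi / real p) * z = rcis r (2 * pi * s / real p)" "0 \<le> r"
      "real (cyc p j) \<le> s" "s \<le> real (cyc p j) + 1"
      by (auto simp: wedge_def)
    then have "cis (2 * pi / real p) * z = cis (2 * pi / real p) * rcis r (2 * pi * (s - 1) / real p)"
      by (simp add: rot)
    then have z: "z = rcis r (2 * pi * (s - 1) / real p)" by simp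
    show "z \<in> wedge p j"
    proof (cases "Suc j = p")
      case True
      have "z = rcis r (2 * pi * (s - 1 + real p) / real p)"
        unfolding z using down[of r "s - 1 + real p"] by simp
      then show ?thesis
        using rs last[OF True] True unfolding wedge_def cyc_def
        by (intro CollectI exI[of _ r] exI[of _ "s - 1 + real p"]) auto
    next
      case False
      then have "cyc p j = Suc j" using j by (simp add: cyc_def)
      then show ?thesis
        using rs z unfolding wedge_def by (intro CollectI exI[of _ r] exI[of _ "s - 1"]) auto
    qed
  qed
qed

section \<open>Fans from complex-affine functions\<close>

locale complex_structure =
  fixes J :: "'a::euclidean_space \<Rightarrow> 'a"
  assumes linear_J: "linear J" and J_J [simp]: "J (J x) = - x" and J_inner: "J x \<bullet> J y = x \<bullet> y"
begin

lemma J_skew: "J x \<bullet> y = - (x \<bullet> J y)"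
  using J_inner[of x "J y"] by simp

lemma inner_J_self [simp]: "x \<bullet> J x = 0" "J x \<bullet> x = 0"
  using J_skew[of x x] by (simp_all add: inner_commute)

lemma J_linear [simp]: "J (x + y) = J x + J y" "J (x - y) = J x - J y" "J (c *\<^sub>R x) = c *\<^sub>R J x" "J 0 = 0"
  using linear_J by (simp_all add: linear_add linear_diff linear_cmul linear_0)

lemma norm_J [simp]: "norm (J x) = norm x"
  by (simp add: norm_eq_sqrt_inner J_inner)

text \<open>Multiplication of the coefficient \<open>a\<close> by \<open>cis \<theta>\<close>. In
  \<open>caff\<close>, \<open>J a\<close> gives the imaginary part, so the imaginary unit acts on
  coefficients as minus \<open>J\<close>.\<close>

definition turn :: "real \<Rightarrow> 'a \<Rightarrow> 'a" where
  "turn \<theta> a = cos \<theta> *\<^sub>R a - sin \<theta> *\<^sub>R J a"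

lemma turn_turn: "turn \<theta> (turn \<phi> a) = turn (\<theta> + \<phi>) a"
  by (simp add: turn_def cos_add sin_add algebra_simps)

lemma turn_0 [simp]: "turn 0 a = a" "turn \<theta> 0 = 0"
  by (simp_all add: turn_def)

lemma linear_turn: "linear (turn \<theta>)"
  by (rule linearI) (simp_all add: turn_def algebra_simps)

lemma inner_turn: "turn \<theta> a \<bullet> turn \<phi> b = cos (\<theta> - \<phi>) * (a \<bullet> b) + sin (\<theta> - \<phi>) * (a \<bullet> J b)"
  by (simp add: turn_def cos_diff sin_diff J_inner J_skew inner_diff_left inner_diff_right algebra_simps)

definition rot :: "real \<Rightarrow> 'a \<times> complex \<Rightarrow> 'a \<times> complex" where
  "rot \<theta> = (\<lambda>(a, b). (turn \<theta> a, cis \<theta> * b))"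

lemma rot_Pair: "rot \<theta> (a, b) = (turn \<theta> a, cis \<theta> * b)"
  by (simp add: rot_def)

lemma linear_rot: "linear (rot \<theta>)"
  by (rule linearI)
    (auto simp: rot_def linear_add[OF linear_turn] linear_cmul[OF linear_turn] algebra_simps)

lemma rot_funpow: "(rot \<theta> ^^ k) = rot (real k * \<theta>)"
proof (induction k)
  case 0
  show ?case by (auto simp: rot_def fun_eq_iff)
next
  case (Suc k)
  have "rot \<theta> \<circ> rot (real k * \<theta>) = rot (\<theta> + real k * \<theta>)"
    by (auto simp: rot_def fun_eq_iff turn_turn cis_mult)
  then show ?case using Suc by (simp add: algebra_simps)
qed

text \<open>The complex-affine function on the Hermitian space \<open>'a\<close> with coefficients \<open>(a, b)\<close>; the preimage
  of a regular fan in the plane is again a regular fan.\<close>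

definition caff :: "'a \<times> complex \<Rightarrow> 'a \<Rightarrow> complex" where
  "caff w x = Complex (fst w \<bullet> x + Re (snd w)) (J (fst w) \<bullet> x + Im (snd w))"

lemma caff_rot: "caff (rot \<theta> w) x = cis \<theta> * caff w x"
  by (simp add: caff_def rot_def case_prod_beta turn_def complex_eq_iff inner_diff_left algebra_simps)

lemma caff_add: "caff w (x + y) = caff w x + Complex (fst w \<bullet> y) (J (fst w) \<bullet> y)"
  by (simp add: caff_def complex_eq_iff inner_add_right)

lemma continuous_J: "continuous_on S J"
  using linear_J linear_continuous_on linear_conv_bounded_linear by blast

lemma continuous_caff: "continuous_on S (\<lambda>x. caff w x)"
  unfolding caff_def by (intro continuous_intros)

lemma tendsto_caff:
  assumes "(w \<longlongrightarrow> w0) F"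
  shows "((\<lambda>k. caff (w k) x) \<longlongrightarrow> caff w0 x) F"
proof -
  have "((\<lambda>k. J (fst (w k))) \<longlongrightarrow> J (fst w0)) F"
    using continuous_J[of UNIV] assms
    by (intro isCont_tendsto_compose[of _ J]) (auto simp: continuous_on_eq_continuous_at intro: tendsto_intros)
  then show ?thesis unfolding caff_def by (intro tendsto_intros assms)
qed

definition sector :: "nat \<Rightarrow> nat \<Rightarrow> 'a \<times> complex \<Rightarrow> 'a set" where
  "sector p j w = {x. caff w x \<in> wedge p j}"

definition wall_set :: "nat \<Rightarrow> 'a \<times> complex \<Rightarrow> 'a set" where
  "wall_set p w = {x. caff w x \<in> walls p}"

lemma sector_borel [measurable]: "sector p j w \<in> sets borel"
  using closed_vimage[OF closed_wedge continuous_caff] by (simp add: sector_def vimage_def)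

lemma wall_set_borel [measurable]: "wall_set p w \<in> sets borel"
  using closed_vimage[OF closed_walls continuous_caff] by (simp add: wall_set_def vimage_def)

lemma sector_rot: "0 < p \<Longrightarrow> j < p \<Longrightarrow> sector p (cyc p j) (rot (2 * pi / real p) w) = sector p j w"
  by (simp add: sector_def caff_rot wedge_shift)

text \<open>Keeping \<open>b\<close> on the bisectors of the sectors makes the masses continuous even at \<open>a = 0\<close>.\<close>

definition mid_ray :: "nat \<Rightarrow> nat \<Rightarrow> complex set" where
  "mid_ray p k = {rcis r (2 * pi * (real k + 1/2) / real p) | r. 0 \<le> r}"

definition params :: "nat \<Rightarrow> ('a \<times> complex) set" where
  "params p = {w. w \<noteq> 0 \<and> (\<exists>k. snd w \<in> mid_ray p k)}"

text \<open>For a = 0 the constant value \<open>b\<close> is a nonzero point of a bisector, so no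
  point is on a wall; otherwise each wall lies in a real hyperplane.\<close>

lemma wall_set_null:
  assumes p: "0 < p" and \<mu>: "signed_mass_distribution \<mu>" and w: "w \<in> params p"
    and E: "E \<in> sets borel" "E \<subseteq> wall_set p w"
  shows "\<mu> E = 0"
proof (cases "fst w = 0")
  case True
  obtain k r where b: "snd w = rcis r (2 * pi * (real k + 1/2) / real p)" "0 \<le> r"
    using w by (auto simp: params_def mid_ray_def)
  have "r \<noteq> 0" using w True b by (auto simp: params_def prod_eq_iff)
  then have "snd w \<notin> walls p" using rcis_mid_notin_walls[OF p] b by simp
  then have "wall_set p w = {}" using True by (simp add: wall_set_def caff_def)
  then show ?thesis using \<mu> E by (simp add: signed_mass_distribution_def finite_signed_borel_measure_def)
next
  case False
  define line where "line k = {x. Im (cis (- (2 * pi * real k / real p)) * caff w x) = 0}" for k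
  have fin: "finite_signed_borel_measure \<mu>" using \<mu> by (simp add: signed_mass_distribution_def)
  have "closed (line k)" for k
  proof -
    have "closed ((\<lambda>x. Im (cis (- (2 * pi * real k / real p)) * caff w x)) -` {0})"
      by (intro closed_vimage continuous_intros continuous_caff closed_singleton)
    then show ?thesis by (simp add: line_def vimage_def)
  qed
  then have line_borel: "line k \<in> sets borel" for k by (rule borel_closed)
  have line_null: "\<mu> E' = 0" if "E' \<in> sets borel" "E' \<subseteq> line k" for E' k
  proof -
    define \<theta> where "\<theta> = 2 * pi * real k / real p"
    \<comment> \<open>The normal vector of the real-affine function whose zero set is
      \<open>line k\<close>.\<close>
    define n where "n = cos \<theta> *\<^sub>R J (fst w) - sin \<theta> *\<^sub>R fst w"
    have "n \<bullet> n = (cos \<theta>)\<^sup>2 * (fst w \<bullet> fst w) + (sin \<theta>)\<^sup>2 * (fst w \<bullet> fst w)"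
      by (simp add: n_def inner_diff_left inner_diff_right J_inner power2_eq_square algebra_simps)
    also have "\<dots> = fst w \<bullet> fst w" by (simp flip: distrib_right)
    finally have "n \<noteq> 0" using False by auto
    have "line k = {x. n \<bullet> x = sin \<theta> * Re (snd w) - cos \<theta> * Im (snd w)}"
      unfolding line_def \<theta>_def[symmetric] n_def
      by (auto simp: caff_def inner_diff_left algebra_simps)
    then show ?thesis
      using \<mu> \<open>n \<noteq> 0\<close> that unfolding signed_mass_distribution_def by blast
  qed
  \<comment> \<open>There is no subadditivity to appeal to, so the set is split along one hyperplane
    at a time.\<close>
  have "\<mu> E' = 0" if "E' \<in> sets borel" "E' \<subseteq> (\<Union>k<q. line k)" for E' q
    using that
  proof (induction q arbitrary: E')
    case 0
    then show ?case using fin by (simp add: finite_signed_borel_measure_def)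
  next
    case (Suc q)
    have "\<mu> (E' \<inter> line q \<union> (E' - line q)) = \<mu> (E' \<inter> line q) + \<mu> (E' - line q)"
      using Suc.prems(1) line_borel by (intro signed_Un[OF fin]) auto
    moreover have "E' \<inter> line q \<union> (E' - line q) = E'" by blast
    moreover have "\<mu> (E' \<inter> line q) = 0"
      using Suc.prems(1) line_borel by (intro line_null) auto
    moreover have "\<mu> (E' - line q) = 0"
      using Suc.prems line_borel by (intro Suc.IH) (auto simp: lessThan_Suc)
    ultimately show ?case by simp
  qed
  moreover have "wall_set p w \<subseteq> (\<Union>k<p. line k)"
  proof
    fix x assume "x \<in> wall_set p w"
    then obtain r k where k: "k < p" and x: "caff w x = rcis r (2 * pi * real k / real p)"
      by (auto simp: wall_set_def walls_def)
    have "cis (- (2 * pi * real k / real p)) * caff w x = of_real r"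
      unfolding x rcis_def by (simp add: cis_mult)
    then have "x \<in> line k"
      unfolding line_def mem_Collect_eq by (simp only: Im_complex_of_real)
    then show "x \<in> (\<Union>k<p. line k)" using k by blast
  qed
  ultimately show ?thesis using E by blast
qed

definition excess :: "nat \<Rightarrow> ('a set \<Rightarrow> real) \<Rightarrow> nat \<Rightarrow> 'a \<times> complex \<Rightarrow> real" where
  "excess p \<mu> j w = \<mu> (sector p j w) - \<mu> UNIV / real p"

text \<open>Sectors overlap only in the walls; removing these null sets leaves a partition of the
  complement of the walls.\<close>

lemma sum_excess:
  assumes p: "0 < p" and \<mu>: "signed_mass_distribution \<mu>" and w: "w \<in> params p"
  shows "(\<Sum>j<p. excess p \<mu> j w) = 0"
proof -
  have fin: "finite_signed_borel_measure \<mu>" using \<mu> by (simp add: signed_mass_distribution_def)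
  have minus: "\<mu> (E - wall_set p w) = \<mu> E" if "E \<in> sets borel" for E
  proof -
    have "E - wall_set p w = E - E \<inter> wall_set p w" by auto
    then show ?thesis
      using signed_Diff[OF fin, of "E \<inter> wall_set p w" E] wall_set_null[OF p \<mu> w, of "E \<inter> wall_set p w"] that
      by simp
  qed
  have "(\<Sum>j<p. \<mu> (sector p j w)) = (\<Sum>j<p. \<mu> (sector p j w - wall_set p w))"
    by (simp add: minus)
  also have "\<dots> = \<mu> (\<Union>j<p. sector p j w - wall_set p w)"
  proof (rule signed_UN_lessThan[OF fin, symmetric])
    have "j = k" if "j < p" "k < p" "x \<in> sector p j w" "x \<in> sector p k w" "x \<notin> wall_set p w" for j k x
      using wedge_unique[OF p, of "caff w x" j k] that by (simp add: sector_def wall_set_def)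
    then show "disjoint_family_on (\<lambda>j. sector p j w - wall_set p w) {..<p}"
      unfolding disjoint_family_on_def by blast
  qed auto
  also have "(\<Union>j<p. sector p j w - wall_set p w) = UNIV - wall_set p w"
  proof -
    have "\<exists>j<p. x \<in> sector p j w" for x
      using wedge_cover[OF p, of "caff w x"] unfolding sector_def by (metis mem_Collect_eq)
    then show ?thesis by auto
  qed
  also have "\<mu> (UNIV - wall_set p w) = \<mu> UNIV" by (simp add: minus)
  finally show ?thesis using p by (simp add: excess_def sum_subtractf)
qed

lemma continuous_excess:
  assumes p: "0 < p" and \<mu>: "signed_mass_distribution \<mu>" and j: "j < p"
  shows "continuous_on (params p) (excess p \<mu> j)"
  unfolding continuous_on_sequentially
proof (intro allI ballI impI, elim conjE)
  fix w w0 assume w0: "w0 \<in> params p" and lim: "w \<longlonglongrightarrow> w0"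
  have "(\<lambda>k. \<mu> (sector p j (w k))) \<longlonglongrightarrow> \<mu> (sector p j w0)"
  proof (rule signed_tendsto)
    show "finite_signed_borel_measure \<mu>" using \<mu> by (simp add: signed_mass_distribution_def)
    show "\<mu> E = 0" if "E \<in> sets borel" "E \<subseteq> wall_set p w0" for E
      using wall_set_null[OF p \<mu> w0] that .
    show "eventually (\<lambda>k. x \<in> sector p j (w k) \<longleftrightarrow> x \<in> sector p j w0) sequentially"
      if "x \<notin> wall_set p w0" for x
      using eventually_wedge[OF p _ j tendsto_caff[OF lim], of x] that
      unfolding sector_def wall_set_def mem_Collect_eq by blast
  qed auto
  then show "(excess p \<mu> j \<circ> w) \<longlonglongrightarrow> excess p \<mu> j w0"
    unfolding comp_def excess_def by (intro tendsto_intros)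
qed

lemma params_rot:
  assumes p: "0 < p" and w: "w \<in> params p"
  shows "rot (2 * pi / real p) w \<in> params p"
proof -
  obtain a b where ab: "w = (a, b)" by fastforce
  obtain k r where b: "b = rcis r (2 * pi * (real k + 1/2) / real p)" "0 \<le> r"
    using w ab by (auto simp: params_def mid_ray_def)
  have "cis (2 * pi / real p) * b = rcis r (2 * pi * (real (Suc k) + 1/2) / real p)"
  proof -
    have "2 * pi * (real (Suc k) + 1/2) = 2 * pi + 2 * pi * (real k + 1/2)"
      by (simp add: distrib_left)
    then have "2 * pi * (real (Suc k) + 1/2) / real p = 2 * pi / real p + 2 * pi * (real k + 1/2) / real p"
      by (simp only: add_divide_distrib)
    then show ?thesis by (simp only: b(1) cis_rcis_eq rcis_mult mult_1)
  qed
  then have "snd (rot (2 * pi / real p) w) \<in> mid_ray p (Suc k)"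
    using b(2) ab unfolding mid_ray_def rot_def by auto
  moreover have "rot (2 * pi / real p) w \<noteq> 0"
  proof
    assume "rot (2 * pi / real p) w = 0"
    then have "rot (- (2 * pi / real p)) (rot (2 * pi / real p) w) = 0"
      using linear_0[OF linear_rot] by simp
    then show False using w by (auto simp: rot_def turn_turn mult.assoc[symmetric] cis_mult ab params_def)
  qed
  ultimately show ?thesis by (auto simp: params_def)
qed

lemma convex_mid_ray: "convex (mid_ray p k)"
proof -
  have "mid_ray p k = (\<lambda>r. r *\<^sub>R cis (2 * pi * (real k + 1/2) / real p)) ` {0..}"
    by (auto simp: mid_ray_def rcis_def scaleR_conv_of_real image_iff)
  then show ?thesis by (auto intro!: convex_linear_image linearI simp: algebra_simps)
qed

text \<open>The last vertex \<open>cis (pi / real p)\<close> lies on the bisector of sector 0. A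
  ladder simplex contains only one translate of it and otherwise has second coordinate 0, so its
  hull stays over a single bisector; it remains to avoid the origin.\<close>

lemma hull_in_params:
  fixes q :: "nat \<Rightarrow> nat" and e :: "nat \<Rightarrow> 'a" and m p :: nat
  defines "v \<equiv> \<lambda>i. if i < m then (e i, 0) else (0, cis (pi / real p))"
  assumes p: "2 < p"
    and e: "\<And>i k. i < m \<Longrightarrow> k < m \<Longrightarrow> e i \<bullet> e k = (if i = k then 1 else 0)"
      "\<And>i k. i < m \<Longrightarrow> k < m \<Longrightarrow> e i \<bullet> J (e k) = 0"
  shows "convex hull (insert ((rot (2 * pi / real p) ^^ q m) (v m))
           (ladder_vertices (rot (2 * pi / real p)) v q m)) \<subseteq> params p"
proof -
  \<comment> \<open>The direction of the midpoint of edge \<open>q k\<close>; both ends of the edge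
    are at angle pi / p from it, and cos (pi / p) is positive because p > 2.\<close>
  define \<theta> where "\<theta> k = 2 * pi * (real (q k) + 1/2) / real p" for k
  define G where "G = (\<Sum>k<m. turn (\<theta> k) (e k))"
  \<comment> \<open>A linear functional that is positive on all the vertices, so that the hull avoids 0.\<close>
  define \<phi> where "\<phi> w = fst w \<bullet> G + Re (cis (- \<theta> m) * snd w)" for w :: "'a \<times> complex"
  have lin: "linear \<phi>"
    by (rule linearI) (simp_all add: \<phi>_def inner_add_left algebra_simps)
  have "{w. \<phi> w > 0} = \<phi> -` {0<..}" by auto
  then have "convex {w. \<phi> w > 0}" using convex_linear_vimage[OF lin convex_real_interval(3)] by simp
  moreover have "{w :: 'a \<times> complex. snd w \<in> mid_ray p (q m)} = snd -` mid_ray p (q m)" by auto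
  then have "convex {w :: 'a \<times> complex. snd w \<in> mid_ray p (q m)}"
    using convex_linear_vimage[OF linear_snd convex_mid_ray] by simp
  ultimately have conv: "convex ({w. \<phi> w > 0} \<inter> {w. snd w \<in> mid_ray p (q m)})"
    by (rule convex_Int)
  have cos_pos: "cos (pi / real p) > 0"
  proof (rule cos_gt_zero)
    show "pi / real p < pi / 2" using p by (intro divide_strict_left_mono) auto
  qed (use p in auto)
  have "\<phi> ((rot (2 * pi / real p) ^^ j) (v i)) = cos (2 * pi * real j / real p - \<theta> i)" if "i < m" for i j
  proof -
    have "turn (2 * pi * real j / real p) (e i) \<bullet> G =
        (\<Sum>k<m. if k = i then cos (2 * pi * real j / real p - \<theta> i) else 0)"
      unfolding G_def inner_sum_right
      by (intro sum.cong) (use that e in \<open>auto simp: inner_turn\<close>)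
    then show ?thesis
      using that by (simp add: \<phi>_def v_def rot_funpow rot_Pair mult.commute)
  qed
  moreover have "2 * pi * real (q i) / real p - \<theta> i = - (pi / real p)"
    "2 * pi * real (Suc (q i)) / real p - \<theta> i = pi / real p" for i
    using p by (simp_all add: \<theta>_def field_simps)
  ultimately have pos: "\<phi> ((rot (2 * pi / real p) ^^ q i) (v i)) > 0"
    "\<phi> ((rot (2 * pi / real p) ^^ Suc (q i)) (v i)) > 0" if "i < m" for i
    using that cos_pos by (simp_all del: funpow.simps)
  have zero_mid: "0 \<in> mid_ray p k" for k by (force simp: mid_ray_def)
  have snd0: "snd ((rot (2 * pi / real p) ^^ j) (v i)) = 0" if "i < m" for i j
    using that by (simp add: v_def rot_funpow rot_Pair)
  have vm: "(rot (2 * pi / real p) ^^ q m) (v m) = (0, cis (\<theta> m))"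
  proof -
    have "real (q m) * (2 * pi / real p) + pi / real p = \<theta> m"
      using p by (simp add: \<theta>_def field_simps)
    then show ?thesis by (simp add: v_def rot_funpow rot_Pair cis_mult)
  qed
  have "cis (\<theta> m) \<in> mid_ray p (q m)"
    unfolding mid_ray_def \<theta>_def by (intro CollectI exI[of _ 1]) (auto simp: cis_rcis_eq)
  then have "insert ((rot (2 * pi / real p) ^^ q m) (v m)) (ladder_vertices (rot (2 * pi / real p)) v q m)
      \<subseteq> {w. \<phi> w > 0} \<inter> {w. snd w \<in> mid_ray p (q m)}"
    unfolding vm ladder_vertices_def using pos snd0 zero_mid
    by (auto simp: \<phi>_def cis_mult simp del: funpow.simps)
  then have "convex hull (insert ((rot (2 * pi / real p) ^^ q m) (v m)) (ladder_vertices (rot (2 * pi / real p)) v q m))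
      \<subseteq> {w. \<phi> w > 0} \<inter> {w. snd w \<in> mid_ray p (q m)}"
    using conv by (rule hull_minimal)
  also have "\<dots> \<subseteq> params p" by (auto simp: params_def \<phi>_def)
  finally show ?thesis .
qed

lemma exists_equipartition_param:
  fixes e :: "nat \<Rightarrow> 'a"
  assumes p: "prime p" "2 < p" and m: "2 * m = (p - 1) * n"
    and e: "\<And>i k. i < m \<Longrightarrow> k < m \<Longrightarrow> e i \<bullet> e k = (if i = k then 1 else 0)"
      "\<And>i k. i < m \<Longrightarrow> k < m \<Longrightarrow> e i \<bullet> J (e k) = 0"
    and \<mu>: "\<And>i. i < n \<Longrightarrow> signed_mass_distribution (\<mu> i)"
  shows "\<exists>w\<in>params p. \<forall>i<n. \<forall>j<p. \<mu> i (sector p j w) = \<mu> i UNIV / real p"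
proof (rule ccontr)
  assume neg: "\<not> ?thesis"
  have p0: "0 < p" using p by simp
  interpret equivariant_family p n "rot (2 * pi / real p)" "params p" "\<lambda>i. excess p (\<mu> i)"
  proof
    show "\<exists>i<n. \<exists>j<p. excess p (\<mu> i) j w \<noteq> 0" if "w \<in> params p" for w
      using neg that by (auto simp: excess_def)
    show "(\<Sum>j<p. excess p (\<mu> i) j w) = 0" if "w \<in> params p" "i < n" for w i
      using sum_excess[OF p0 \<mu>] that by blast
  qed (use p p0 in \<open>simp_all add: params_rot excess_def sector_rot\<close>)
  have "rot (2 * pi / real p) ^^ p = id"
    using p0 by (auto simp: rot_funpow rot_Pair turn_def fun_eq_iff)
  then show False
    using no_equivariant_family[OF linear_rot _ m, of "\<lambda>i. if i < m then (e i, 0) else (0, cis (pi / real p))"]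
      hull_in_params[OF p(2) e] continuous_excess[OF p0 \<mu>] by blast
qed

section \<open>Preimages of the planar fan as regular fans\<close>

lemma caff_normal_direction:
  assumes a: "fst w \<noteq> 0"
  shows "caff w (x + r *\<^sub>R normal_direction (fst w /\<^sub>R norm (fst w)) (J (fst w) /\<^sub>R norm (fst w)) \<theta>) =
    caff w x + rcis (r * norm (fst w)) \<theta>"
proof -
  have "fst w \<bullet> fst w = norm (fst w) * norm (fst w)"
    by (simp add: dot_square_norm power2_eq_square)
  then show ?thesis
    using a by (simp add: caff_add normal_direction_def complex_eq_iff inner_add_right J_inner)
qed

lemma half_hyperplane_caff:
  assumes a: "fst w \<noteq> 0"
  shows "half_hyperplane {x. caff w x = 0}
      (normal_direction (fst w /\<^sub>R norm (fst w)) (J (fst w) /\<^sub>R norm (fst w)) \<theta>) =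
    {x. \<exists>r\<ge>0. caff w x = rcis r \<theta>}" (is "half_hyperplane ?L ?d = _")
proof (intro equalityI subsetI)
  fix x assume "x \<in> half_hyperplane ?L ?d"
  then obtain y r where "x = y + r *\<^sub>R ?d" "caff w y = 0" "0 \<le> r"
    by (auto simp: half_hyperplane_def)
  then have "caff w x = rcis (r * norm (fst w)) \<theta>" "0 \<le> r * norm (fst w)"
    using caff_normal_direction[OF a] by simp_all
  then show "x \<in> {x. \<exists>r\<ge>0. caff w x = rcis r \<theta>}" by blast
next
  fix x assume "x \<in> {x. \<exists>r\<ge>0. caff w x = rcis r \<theta>}"
  then obtain r where r: "0 \<le> r" "caff w x = rcis r \<theta>" by blast
  let ?y = "x + (- (r / norm (fst w))) *\<^sub>R ?d"
  have "caff w ?y = 0"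
    unfolding caff_normal_direction[OF a] using r a by (simp add: rcis_def)
  moreover have "x = ?y + (r / norm (fst w)) *\<^sub>R ?d" by simp
  ultimately show "x \<in> half_hyperplane ?L ?d"
    unfolding half_hyperplane_def using r(1)
    by (intro CollectI exI[of _ ?y] exI[of _ "r / norm (fst w)"]) simp
qed

lemma closed_sector_caff:
  assumes a: "fst w \<noteq> 0" and p: "0 < p"
  shows "closed_sector {x. caff w x = 0} (fst w /\<^sub>R norm (fst w)) (J (fst w) /\<^sub>R norm (fst w))
      (2 * pi * real k / real p) (2 * pi * real (k + 1) / real p) = sector p k w"
proof -
  have "(\<exists>\<theta>\<in>{2 * pi * real k / real p..2 * pi * real (k + 1) / real p}. \<exists>r\<ge>0. z = rcis r \<theta>) \<longleftrightarrow>
      z \<in> wedge p k" for z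
  proof
    assume "\<exists>\<theta>\<in>{2 * pi * real k / real p..2 * pi * real (k + 1) / real p}. \<exists>r\<ge>0. z = rcis r \<theta>"
    then obtain \<theta> r where *: "2 * pi * real k / real p \<le> \<theta>" "\<theta> \<le> 2 * pi * real (k + 1) / real p"
      "0 \<le> r" "z = rcis r \<theta>" by auto
    define s where "s = real p * \<theta> / (2 * pi)"
    have "\<theta> = 2 * pi * s / real p" using p by (simp add: s_def)
    moreover have "real k \<le> s" "s \<le> real k + 1" using * p by (simp_all add: s_def field_simps)
    ultimately show "z \<in> wedge p k" using * by (auto simp: wedge_def)
  next
    assume "z \<in> wedge p k"
    then obtain r s where *: "z = rcis r (2 * pi * s / real p)" "0 \<le> r" "real k \<le> s" "s \<le> real k + 1"
      by (auto simp: wedge_def)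
    then have "2 * pi * s / real p \<in> {2 * pi * real k / real p..2 * pi * real (k + 1) / real p}"
      by (auto intro!: divide_right_mono mult_left_mono)
    then show "\<exists>\<theta>\<in>{2 * pi * real k / real p..2 * pi * real (k + 1) / real p}. \<exists>r\<ge>0. z = rcis r \<theta>"
      using * by blast
  qed
  then show ?thesis
    unfolding closed_sector_def half_hyperplane_caff[OF a] sector_def by blast
qed

text \<open>The zero set is cut out by two real hyperplanes with nonzero orthogonal normals
  \<open>a\<close> and \<open>J a\<close>, hence transversal.\<close>

lemma codim2_flat_caff:
  assumes a: "fst w \<noteq> 0"
  shows "codim2_flat {x. caff w x = 0}"
proof -
  let ?a = "fst w"
  let ?A = "{x. ?a \<bullet> x = - Re (snd w)}" and ?B = "{x. J ?a \<bullet> x = - Im (snd w)}"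
  have eq: "{x. caff w x = 0} = ?A \<inter> ?B"
    by (auto simp: caff_def complex_eq_iff)
  have solve: "\<exists>x. ?a \<bullet> x = c \<and> J ?a \<bullet> x = d" for c d
    using a by (intro exI[of _ "(c / (?a \<bullet> ?a)) *\<^sub>R ?a + (d / (?a \<bullet> ?a)) *\<^sub>R J ?a"])
      (simp add: inner_add_right J_inner)
  have "?A \<inter> ?B \<noteq> {}" using solve by blast
  moreover have "\<not> ?A \<subseteq> ?B" using solve[of "- Re (snd w)" "1 - Im (snd w)"] by force
  ultimately have "aff_dim (?A \<inter> ?B) = aff_dim ?A - 1"
    by (simp only: aff_dim_affine_Int_hyperplane[OF affine_hyperplane] if_False)
  also have "aff_dim ?A = int DIM('a) - 1" using a by simp
  finally show ?thesis
    unfolding codim2_flat_def eq by (auto intro: affine_Int affine_hyperplane)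
qed

lemma regular_fan_caff:
  assumes a: "fst w \<noteq> 0" and p: "0 < p"
  shows "\<exists>F. regular_fan_with_sectors p F (\<lambda>k. sector p k w)"
proof -
  let ?L = "{x. caff w x = 0}"
  let ?u = "fst w /\<^sub>R norm (fst w)" and ?v = "J (fst w) /\<^sub>R norm (fst w)"
  have "orthonormal_frame_normal_to ?L ?u ?v"
    using a unfolding orthonormal_frame_normal_to_def
    by (auto simp: orthogonal_def caff_def complex_eq_iff inner_diff_left inner_commute[of _ "fst w"]
        inner_commute[of _ "J (fst w)"] inner_diff_right)
  then show ?thesis
    unfolding regular_fan_with_sectors_def
    using codim2_flat_caff[OF a] closed_sector_caff[OF a p] by metis
qed

lemma equipartition_nondegenerate:
  assumes p: "1 < p" and w: "w \<in> params p" and \<mu>: "signed_mass_distribution \<mu>"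
    and eq: "\<And>j. j < p \<Longrightarrow> \<mu> (sector p j w) = \<mu> UNIV / real p"
  shows "fst w \<noteq> 0"
proof
  assume "fst w = 0"
  then have s: "sector p j w = (if snd w \<in> wedge p j then UNIV else {})" for j
    by (simp add: sector_def caff_def)
  obtain j where "j < p" "snd w \<in> wedge p j" using wedge_cover[of p "snd w"] p by auto
  then have "\<mu> UNIV = \<mu> UNIV / real p" using eq[of j] s by simp
  then have "\<mu> UNIV = 0" using p by (simp add: field_simps)
  then show False using \<mu> by (simp add: signed_mass_distribution_def)
qed

end

text \<open>Coordinates are enumerated and paired as 2i, 2i + 1; \<open>J\<close> swaps partners
  with a sign. The \<open>e i\<close> are the even axes, an orthonormal complex basis, since
  \<open>J\<close> sends them to odd axes up to sign.\<close>

lemma exists_complex_structure: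
  assumes "CARD('n::finite) = 2 * m"
  obtains J :: "real ^ 'n \<Rightarrow> real ^ 'n" and e :: "nat \<Rightarrow> real ^ 'n" where "complex_structure J"
    "\<And>i k. i < m \<Longrightarrow> k < m \<Longrightarrow> e i \<bullet> e k = (if i = k then 1 else 0)"
    "\<And>i k. i < m \<Longrightarrow> k < m \<Longrightarrow> e i \<bullet> J (e k) = 0"
proof -
  obtain b :: "nat \<Rightarrow> 'n" where b: "bij_betw b {..<2 * m} UNIV"
    using ex_bij_betw_nat_finite[of "UNIV :: 'n set"] assms by (auto simp: atLeast0LessThan)
  define c where "c = the_inv_into {..<2 * m} b"
  have c: "c (b i) = i" if "i < 2 * m" for i
    using b that unfolding c_def bij_betw_def by (simp add: the_inv_into_f_f)
  have bc: "b (c x) = x" and c_less: "c x < 2 * m" for x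
    using b the_inv_into_into[of b "{..<2 * m}" x "{..<2 * m}"]
    unfolding c_def bij_betw_def by (auto simp: f_the_inv_into_f)
  define flip where "flip i = (if even i then Suc i else i - 1)" for i :: nat
  have flip: "flip (flip i) = i" "even (flip i) \<longleftrightarrow> odd i" "i < 2 * m \<Longrightarrow> flip i < 2 * m" for i
    by (auto simp: flip_def elim!: evenE oddE)
  define \<sigma> where "\<sigma> x = b (flip (c x))" for x
  define s :: "'n \<Rightarrow> real" where "s x = (if even (c x) then 1 else -1)" for x
  have \<sigma>: "\<sigma> (\<sigma> x) = x" and s: "s (\<sigma> x) = - s x" "s x * s x = 1" for x
    by (simp_all add: \<sigma>_def s_def c flip c_less bc)
  define J :: "real ^ 'n \<Rightarrow> real ^ 'n" where "J x = (\<chi> k. s k * x $ \<sigma> k)" for x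
  define e :: "nat \<Rightarrow> real ^ 'n" where "e i = axis (b (2 * i)) 1" for i
  have "complex_structure J"
  proof (rule complex_structure.intro)
    show "linear J" by (rule linearI) (simp_all add: J_def vec_eq_iff algebra_simps)
    show "J (J x) = - x" for x
    proof -
      have "s k * (s (\<sigma> k) * x $ k) = - (s k * s k) * x $ k" for k by (simp add: s)
      then show ?thesis by (simp add: J_def vec_eq_iff \<sigma> s)
    qed
    show "J x \<bullet> J y = x \<bullet> y" for x y
    proof -
      have "J x \<bullet> J y = (\<Sum>k\<in>UNIV. (s k * s k) * (x $ \<sigma> k * y $ \<sigma> k))"
        by (simp add: J_def inner_vec_def algebra_simps)
      also have "\<dots> = (\<Sum>k\<in>UNIV. x $ \<sigma> k * y $ \<sigma> k)" by (simp add: s)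
      also have "\<dots> = (\<Sum>k\<in>UNIV. x $ k * y $ k)"
        by (rule sum.reindex_bij_witness[of _ \<sigma> \<sigma>]) (auto simp: \<sigma>)
      finally show ?thesis by (simp add: inner_vec_def)
    qed
  qed
  moreover have b_eq: "b i = b k \<longleftrightarrow> i = k" if "i < 2 * m" "k < 2 * m" for i k
    using c that by metis
  have "e i \<bullet> e k = (if i = k then 1 else 0)" if "i < m" "k < m" for i k
    using that by (simp add: e_def inner_axis_axis b_eq)
  moreover have "e i \<bullet> J (e k) = 0" if "i < m" "k < m" for i k
  proof -
    have "2 * k \<noteq> Suc (2 * i)" by presburger
    then have "b (2 * k) \<noteq> \<sigma> (b (2 * i))" using that by (simp add: \<sigma>_def c flip_def b_eq)
    then have "J (e k) $ b (2 * i) = 0" by (simp add: J_def e_def axis_def)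
    then show ?thesis by (simp add: e_def inner_axis')
  qed
  ultimately show thesis using that by blast
qed

theorem corollary5:
  fixes p n :: nat and \<mu> :: "nat \<Rightarrow> (real ^ 'N) set \<Rightarrow> real"
  assumes "prime p" and "odd p" and "n \<ge> 1"
    and "CARD('N) = (p - 1) * n"
    and "\<And>i. i \<in> {1..n} \<Longrightarrow> signed_mass_distribution (\<mu> i)"
  shows "\<exists>(F :: (real ^ 'N) set) S. regular_fan_with_sectors p F S \<and>
           (\<forall>i\<in>{1..n}. \<forall>k<p. \<mu> i (S k) = 1 / real p * \<mu> i UNIV)"
proof -
  have p: "2 < p" using assms(1,2) prime_ge_2_nat[of p] by (cases "p = 2") auto
  \<comment> \<open>Oddness of \<open>p\<close> is what makes the dimension even, so that a complex
    structure exists.\<close>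
  have "even ((p - 1) * n)" using assms(2) by simp
  then obtain m where m: "(p - 1) * n = 2 * m" by (rule evenE)
  obtain J :: "real ^ 'N \<Rightarrow> real ^ 'N" and e :: "nat \<Rightarrow> real ^ 'N" where "complex_structure J"
    and e: "\<And>i k. i < m \<Longrightarrow> k < m \<Longrightarrow> e i \<bullet> e k = (if i = k then 1 else 0)"
      "\<And>i k. i < m \<Longrightarrow> k < m \<Longrightarrow> e i \<bullet> J (e k) = 0"
    using exists_complex_structure assms(4) m by metis
  interpret complex_structure J by fact
  obtain w where w: "w \<in> params p"
    and eq: "\<And>i j. i < n \<Longrightarrow> j < p \<Longrightarrow> \<mu> (Suc i) (sector p j w) = \<mu> (Suc i) UNIV / real p"
    using exists_equipartition_param[OF assms(1) p m[symmetric] e, of "\<lambda>i. \<mu> (Suc i)"] assms(5) by auto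
  have "fst w \<noteq> 0"
    \<comment> \<open>Since n is at least 1, there is a measure of nonzero total mass to exclude a =
      0.\<close>
    using equipartition_nondegenerate[OF _ w assms(5)[of 1]] eq[of 0] p assms(3) by simp
  then obtain F where "regular_fan_with_sectors p F (\<lambda>k. sector p k w)"
    using regular_fan_caff[of w p] p by auto
  moreover have "\<mu> i (sector p k w) = 1 / real p * \<mu> i UNIV" if "i \<in> {1..n}" "k < p" for i k
    using eq[of "i - 1" k] that by (cases i) auto
  ultimately show ?thesis by blast
qed

end
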